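(* Let $0<\varepsilon<1$ and suppose that $(1/2+\varepsilon)\log n\le d=d(n)\le\log^3 n$. Let $G\in\mathcal G(n,p)$ with $p=d/(n-1)$. Then asymptotically almost surely $c(G)=O(\sqrt n)$.
   Context: $\mathcal G(n,p)$ is the binomial random graph on $\{1,\dots,n\}$ with each pair joined independently with probability $p$. A.a.s. means with probability tending to $1$ as $n\to\infty$; the claim means there is a constant $K$ with $\mathbb P(c(G)\le K\sqrt n)\to1$. $\log$ is natural. The cop number $c(G)$ is the minimum number of cops that can guarantee capture of the robber in the game of Cops and Robbers on $G$ (cops choose initial vertices, then the robber; then cops and robber alternately move along an edge or stay put, with full information; cops win if a cop occupies the robber's vertex). *)

theory Defs
  imports "HOL-Analysis.Analysis"
begin

definition all_edges :: "nat \<Rightarrow> nat set set" where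
  "all_edges n = {e. \<exists>u v. e = {u, v} \<and> u \<noteq> v \<and> u \<in> {1..n} \<and> v \<in> {1..n}}"

definition Gnp_prob :: "nat \<Rightarrow> real \<Rightarrow> (nat set set \<Rightarrow> bool) \<Rightarrow> real" where
  "Gnp_prob n p P =
     (\<Sum>E \<in> Pow (all_edges n).
        if P E then p ^ card E * (1 - p) ^ (card (all_edges n) - card E) else 0)"

definition step_ok :: "nat set set \<Rightarrow> nat \<Rightarrow> nat \<Rightarrow> bool" where
  "step_ok E x y \<longleftrightarrow> y = x \<or> {x, y} \<in> E"

(* Cops-and-robber positions from which the cops can force capture.
   cop_wins E True cs r : cops (positions cs) are to move, robber at r;
   cop_wins E False cs r : robber is to move. *)
inductive cop_wins :: "nat set set \<Rightarrow> bool \<Rightarrow> nat list \<Rightarrow> nat \<Rightarrow> bool" for E where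
  caught: "r \<in> set cs \<Longrightarrow> cop_wins E t cs r"
| cops_move: "\<lbrakk> length cs' = length cs; \<forall>i < length cs. step_ok E (cs ! i) (cs' ! i);
               cop_wins E False cs' r \<rbrakk> \<Longrightarrow> cop_wins E True cs r"
| robber_move: "\<lbrakk> \<forall>r'. step_ok E r r' \<longrightarrow> cop_wins E True cs r' \<rbrakk> \<Longrightarrow> cop_wins E False cs r"

definition cops_win :: "nat set \<Rightarrow> nat set set \<Rightarrow> nat \<Rightarrow> bool" where
  "cops_win V E k \<longleftrightarrow>
     (\<exists>cs. length cs = k \<and> set cs \<subseteq> V \<and> (\<forall>r \<in> V. cop_wins E True cs r))"

definition cop_number :: "nat set \<Rightarrow> nat set set \<Rightarrow> nat" where
  "cop_number V E = (LEAST k. cops_win V E k)"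

end

theory Submission
  imports Defs "HOL-Real_Asymp.Real_Asymp"
begin

text \<open>
  Choose \<open>r\<close> with \<open>d\<^sup>r \<le> \<surd>n < d\<^bsup>r+1\<^esup>\<close>. Up to \<open>\<surd>n\<close> cops sit for ever on the vertices of
  degree below a small multiple of \<open>d\<close>; the bound \<open>d \<ge> (1/2 + \<epsilon>) log n\<close> says exactly that there are
  so few of them. All other vertex sets \<open>S\<close> expand: the ball of radius \<open>j \<in> {r+1, r+2}\<close> around \<open>S\<close>
  has size of order \<open>|S| d\<^sup>j\<close> as long as this is at most a small multiple of \<open>n\<close>. Two more teams of
  cops start on a common random set of density of order \<open>1/\<surd>n\<close>.

  Once the robber has chosen \<open>v\<close>, he is after \<open>r\<close> moves inside the ball of radius \<open>r\<close> around \<open>v\<close>,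
  of size \<open>O(d\<^sup>r)\<close>. By Hall's theorem the first team can occupy this ball in \<open>r + 1\<close> moves, except
  for a set \<open>U\<close> with \<open>|U| = O(\<surd>n/d)\<close> (this defect is unavoidable when \<open>d\<^bsup>r+1\<^esup>\<close> is close to
  \<open>\<surd>n\<close>). The closed neighbourhood of \<open>U\<close> has size \<open>O(\<surd>n)\<close>, and the second team has one more
  move, that is a factor \<open>d\<close> more cops within reach, which is enough to occupy it completely. So the
  robber is caught at move \<open>r + 1\<close> or \<open>r + 2\<close>.

  The growth and expansion estimates come from exponential moments of the layer sizes of a
  breadth-first search, propagated backwards from the last layer to the first.
\<close>

section \<open>Random subsets\<close>

text \<open>The main obstacle is the first step of the expansion. A union bound over up to
  \<open>n ^ s\<close> sets of size \<open>s\<close> wants failure probability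
  \<open>n ^ (-3 s)\<close>, but a single vertex is isolated with probability about
  \<open>exp (- d)\<close>, close to \<open>n ^ (-1/2)\<close> at the bottom of the range. So the
  first layer is bounded deterministically: sets of at most \<open>n / d^2\<close> vertices span
  fewer than four edges per vertex, hence vertices of degree at least \<open>16 \<kappa> d\<close>
  have on average at least \<open>\<kappa> d\<close> new neighbours. Each of these carries a
  constant exponent of order \<open>1 / \<kappa>\<close>, and the later layers fail only with
  probability \<open>exp (- 6 d s) \<le> n ^ (-3 s)\<close>. The number of rounds grows with
  \<open>n\<close>, so no constant factor may be lost per round; the exponents carry corrections
  that form geometric series. For the first team only subsets of the balls count, at most
  \<open>2 ^ |ball|\<close> for each centre, so a constant number of cops per ball vertex beats the
  union bound. The bound \<open>log^3 n\<close> enters mainly as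
  \<open>d^2 \<le> sqrt n / 960\<close> and \<open>ln (4 n) \<le> sqrt n / d\<close>.\<close>

definition expect :: "'a set \<Rightarrow> real \<Rightarrow> ('a set \<Rightarrow> real) \<Rightarrow> real" where
  "expect A p f = (\<Sum>E\<in>Pow A. p ^ card E * (1 - p) ^ (card A - card E) * f E)"

definition prb :: "'a set \<Rightarrow> real \<Rightarrow> ('a set \<Rightarrow> bool) \<Rightarrow> real" where
  "prb A p P = expect A p (\<lambda>E. of_bool (P E))"

text \<open>The weights are those of \<open>Gnp_prob\<close>; the ground set is kept abstract
  because the cops' starting vertices are later drawn from the same kind of measure on
  \<open>{1..n}\<close>.\<close>

lemma Gnp_prob_eq_prb: "Gnp_prob n p P = prb (all_edges n) p P"
  unfolding Gnp_prob_def prb_def expect_def by (intro sum.cong) auto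

text \<open>Fubini for the product measure: a subset of a disjoint union splits uniquely into its
  two traces, and the weights multiply. All independence below rests on this.\<close>

lemma expect_union:
  assumes "finite A" "finite B" "A \<inter> B = {}"
  shows "expect (A \<union> B) p f = expect A p (\<lambda>E1. expect B p (\<lambda>E2. f (E1 \<union> E2)))"
proof -
  have inj: "inj_on (\<lambda>(E1, E2). E1 \<union> E2) (Pow A \<times> Pow B)"
  proof (rule inj_onI, clarify)
    fix E1 E2 F1 F2 assume s: "E1 \<subseteq> A" "E2 \<subseteq> B" "F1 \<subseteq> A" "F2 \<subseteq> B" and e: "E1 \<union> E2 = F1 \<union> F2"
    have "E1 = (E1 \<union> E2) \<inter> A" "F1 = (F1 \<union> F2) \<inter> A" "E2 = (E1 \<union> E2) \<inter> B" "F2 = (F1 \<union> F2) \<inter> B"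
      using s assms(3) by blast+
    then show "E1 = F1 \<and> E2 = F2" using e by metis
  qed
  have im: "(\<lambda>(E1, E2). E1 \<union> E2) ` (Pow A \<times> Pow B) = Pow (A \<union> B)"
  proof -
    have "E \<in> (\<lambda>(E1, E2). E1 \<union> E2) ` (Pow A \<times> Pow B)" if "E \<subseteq> A \<union> B" for E
      by (rule image_eqI[of _ _ "(E \<inter> A, E \<inter> B)"]) (use that in auto)
    then show ?thesis by blast
  qed
  have wt: "p ^ card (E1 \<union> E2) * (1 - p) ^ (card (A \<union> B) - card (E1 \<union> E2))
      = (p ^ card E1 * (1 - p) ^ (card A - card E1)) * (p ^ card E2 * (1 - p) ^ (card B - card E2))"
    if "E1 \<subseteq> A" "E2 \<subseteq> B" for E1 E2
  proof -
    have "E1 \<inter> E2 = {}" using that assms(3) by auto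
    then have c: "card (E1 \<union> E2) = card E1 + card E2"
      using that assms by (meson finite_subset card_Un_disjoint)
    have l: "card E1 \<le> card A" "card E2 \<le> card B"
      using that assms by (simp_all add: card_mono)
    have "card (A \<union> B) - card (E1 \<union> E2) = (card A - card E1) + (card B - card E2)"
      using c l card_Un_disjoint[OF assms] by simp
    then show ?thesis using c by (simp add: power_add)
  qed
  have "expect (A \<union> B) p f = (\<Sum>(E1, E2)\<in>Pow A \<times> Pow B.
      p ^ card (E1 \<union> E2) * (1 - p) ^ (card (A \<union> B) - card (E1 \<union> E2)) * f (E1 \<union> E2))"
    unfolding expect_def im[symmetric] by (subst sum.reindex[OF inj]) (simp add: case_prod_unfold)
  also have "\<dots> = (\<Sum>(E1, E2)\<in>Pow A \<times> Pow B. (p ^ card E1 * (1 - p) ^ (card A - card E1))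
      * ((p ^ card E2 * (1 - p) ^ (card B - card E2)) * f (E1 \<union> E2)))"
    by (intro sum.cong refl) (auto simp: wt mult.assoc)
  also have "\<dots> = expect A p (\<lambda>E1. expect B p (\<lambda>E2. f (E1 \<union> E2)))"
    unfolding expect_def by (simp add: sum.cartesian_product[symmetric] sum_distrib_left)
  finally show ?thesis .
qed

lemma expect_cong: "(\<And>E. E \<subseteq> A \<Longrightarrow> f E = g E) \<Longrightarrow> expect A p f = expect A p g"
  unfolding expect_def by (intro sum.cong) auto

lemma expect_mono:
  assumes "0 \<le> p" "p \<le> 1" "\<And>E. E \<subseteq> A \<Longrightarrow> f E \<le> g E"
  shows "expect A p f \<le> expect A p g"
  unfolding expect_def using assms by (intro sum_mono mult_left_mono) auto

lemma expect_cmult: "expect A p (\<lambda>E. c * f E) = c * expect A p f"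
  unfolding expect_def sum_distrib_left by (intro sum.cong) (auto simp: mult_ac)

lemma expect_cmult_right: "expect A p (\<lambda>E. f E * c) = expect A p f * c"
  unfolding expect_def sum_distrib_right by (intro sum.cong) (auto simp: mult_ac)

lemma expect_add: "expect A p (\<lambda>E. f E + g E) = expect A p f + expect A p g"
  unfolding expect_def by (simp add: sum.distrib distrib_left)

lemma expect_sum: "expect A p (\<lambda>E. \<Sum>i\<in>I. f i E) = (\<Sum>i\<in>I. expect A p (f i))"
  unfolding expect_def sum_distrib_left by (rule sum.swap)

lemma expect_empty [simp]: "expect {} p f = f {}"
  by (simp add: expect_def)

lemma expect_singleton: "expect {a} p f = (1 - p) * f {} + p * f {a}"
proof -
  have "Pow {a} = {{}, {a}}" by auto
  then show ?thesis by (simp add: expect_def)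
qed

lemma expect_nonneg:
  assumes "0 \<le> p" "p \<le> 1" "\<And>E. E \<subseteq> A \<Longrightarrow> 0 \<le> f E"
  shows "0 \<le> expect A p f"
  unfolding expect_def using assms by (intro sum_nonneg mult_nonneg_nonneg) auto

text \<open>The binomial generating function, source of the tail bounds below: \<open>z > 1\<close>
  for upper tails, \<open>z < 1\<close> for lower tails, and \<open>z = 0\<close> for the
  probability of missing \<open>F\<close> altogether.\<close>

lemma expect_power_card:
  assumes "finite A" "F \<subseteq> A"
  shows "expect A p (\<lambda>E. z ^ card (E \<inter> F)) = (1 + (z - 1) * p) ^ card F"
  using assms
proof (induction A arbitrary: F rule: finite_induct)
  case empty
  then show ?case by simp
next
  case (insert x A)
  let ?c = "1 + (z - 1) * p"
  have s: "expect (insert x A) p (\<lambda>E. z ^ card (E \<inter> F)) =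
      expect {x} p (\<lambda>E1. expect A p (\<lambda>E2. z ^ card ((E1 \<union> E2) \<inter> F)))"
    using expect_union[of "{x}" A] insert by simp
  let ?z = "if x \<in> F then z else 1"
  have r: "z ^ card (E2 \<inter> F) = z ^ card (E2 \<inter> (F - {x}))"
    "z ^ card (insert x E2 \<inter> F) = ?z * z ^ card (E2 \<inter> (F - {x}))"
    if "E2 \<subseteq> A" for E2
  proof -
    have a: "E2 \<inter> F = E2 \<inter> (F - {x})" using that insert by blast
    then have i: "insert x E2 \<inter> F = (if x \<in> F then insert x (E2 \<inter> (F - {x})) else E2 \<inter> (F - {x}))"
      by (metis Int_insert_left_if0 Int_insert_left_if1)
    have "finite E2" using that insert by (meson finite_subset)
    then show "z ^ card (insert x E2 \<inter> F) = ?z * z ^ card (E2 \<inter> (F - {x}))"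
      unfolding i by simp
    show "z ^ card (E2 \<inter> F) = z ^ card (E2 \<inter> (F - {x}))" using a by simp
  qed
  have e1: "expect A p (\<lambda>E2. z ^ card (E2 \<inter> F)) = expect A p (\<lambda>E2. z ^ card (E2 \<inter> (F - {x})))"
    by (rule expect_cong) (rule r(1))
  have e2: "expect A p (\<lambda>E2. z ^ card (insert x E2 \<inter> F)) =
      ?z * expect A p (\<lambda>E2. z ^ card (E2 \<inter> (F - {x})))"
    unfolding expect_cmult[symmetric] by (rule expect_cong) (rule r(2))
  have e3: "expect A p (\<lambda>E2. z ^ card (E2 \<inter> (F - {x}))) = ?c ^ card (F - {x})"
    using insert by (intro insert.IH) auto
  have e: "expect (insert x A) p (\<lambda>E. z ^ card (E \<inter> F)) =
    ((1 - p) + p * ?z) * ?c ^ card (F - {x})"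
    unfolding s expect_singleton Un_insert_left Un_empty_left e1 e2 e3 by (simp only: ring_distribs mult.assoc)
  have fF: "finite F" using insert.prems insert.hyps by (meson finite_insert finite_subset)
  show ?case
  proof (cases "x \<in> F")
    case True
    then have "card F = Suc (card (F - {x}))" using fF by (metis card_Suc_Diff1)
    then have "?c ^ card F = ?c * ?c ^ card (F - {x})" by simp
    moreover have "(1 - p) + p * ?z = ?c" using True by (simp add: algebra_simps)
    ultimately show ?thesis using e by simp
  next
    case False
    then show ?thesis using e by simp
  qed
qed

lemma expect_const [simp]: "finite A \<Longrightarrow> expect A p (\<lambda>_. c) = c"
  using expect_power_card[of A "{}" p 1] expect_cmult[of A p c "\<lambda>_. 1"] by simp

text \<open>Dependence on the coordinates inside or outside \<open>F\<close> is expressed as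
  invariance under restriction, so the two functions need not be rewritten on smaller ground
  sets.\<close>

lemma expect_indep:
  assumes fin: "finite A" and F: "F \<subseteq> A"
    and f: "\<And>E. E \<subseteq> A \<Longrightarrow> f (E \<inter> F) = f E" and g: "\<And>E. E \<subseteq> A \<Longrightarrow> g (E - F) = g E"
  shows "expect A p (\<lambda>E. f E * g E) = expect A p f * expect A p g"
proof -
  have A: "A = F \<union> (A - F)" and fin': "finite F" "finite (A - F)"
    using F fin finite_subset by auto
  have split: "expect A p h = expect F p (\<lambda>E1. expect (A - F) p (\<lambda>E2. h (E1 \<union> E2)))" for h
    by (subst A, rule expect_union) (use fin' in auto)
  have f': "f (E1 \<union> E2) = f E1" and g': "g (E1 \<union> E2) = g E2"
    if "E1 \<subseteq> F" "E2 \<subseteq> A - F" for E1 E2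
  proof -
    have "(E1 \<union> E2) \<inter> F = E1" "(E1 \<union> E2) - F = E2" "E1 \<union> E2 \<subseteq> A"
      using that F by auto
    then show "f (E1 \<union> E2) = f E1" "g (E1 \<union> E2) = g E2" using f g by metis+
  qed
  have "expect A p (\<lambda>E. f E * g E) = expect F p (\<lambda>E1. expect (A - F) p (\<lambda>E2. f E1 * g E2))"
    unfolding split by (intro expect_cong) (simp add: f' g')
  also have "\<dots> = expect F p f * expect (A - F) p g"
    by (simp add: expect_cmult expect_cmult_right)
  also have "expect F p f = expect A p f"
    unfolding split using fin' by (intro expect_cong) (simp add: f' cong: expect_cong)
  also have "expect (A - F) p g = expect A p g"
  proof -
    have "expect A p g = expect F p (\<lambda>E1. expect (A - F) p g)"
      unfolding split by (intro expect_cong) (simp add: g')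
    then show ?thesis using fin' by simp
  qed
  finally show ?thesis .
qed

lemma expect_prod:
  assumes fin: "finite A" and "finite I"
    and F: "\<And>i. i \<in> I \<Longrightarrow> F i \<subseteq> A"
    and disj: "disjoint_family_on F I"
    and f: "\<And>i E. i \<in> I \<Longrightarrow> E \<subseteq> A \<Longrightarrow> f i (E \<inter> F i) = f i E"
  shows "expect A p (\<lambda>E. \<Prod>i\<in>I. f i E) = (\<Prod>i\<in>I. expect A p (f i))"
  using \<open>finite I\<close> F disj f
proof (induction I rule: finite_induct)
  case empty
  then show ?case using fin by simp
next
  case (insert x I)
  have g: "(\<Prod>i\<in>I. f i (E - F x)) = (\<Prod>i\<in>I. f i E)" if "E \<subseteq> A" for E
  proof (intro prod.cong refl)
    fix i assume i: "i \<in> I"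
    have "F i \<inter> F x = {}"
      using insert.prems(2) insert.hyps i unfolding disjoint_family_on_def by auto
    then have "(E - F x) \<inter> F i = E \<inter> F i" by auto
    then show "f i (E - F x) = f i E"
      using insert.prems(3)[of i E] insert.prems(3)[of i "E - F x"] i that
      by (metis Diff_subset insertCI order_trans)
  qed
  have "expect A p (\<lambda>E. f x E * (\<Prod>i\<in>I. f i E)) = expect A p (f x) * expect A p (\<lambda>E. \<Prod>i\<in>I. f i E)"
    by (rule expect_indep[OF fin, of "F x"]) (use insert.prems g in auto)
  also have "expect A p (\<lambda>E. \<Prod>i\<in>I. f i E) = (\<Prod>i\<in>I. expect A p (f i))"
    by (rule insert.IH) (use insert.prems in \<open>auto simp: disjoint_family_on_def\<close>)
  finally show ?case using insert.hyps by simp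
qed

lemma prb_mono:
  assumes "0 \<le> p" "p \<le> 1" "\<And>E. E \<subseteq> A \<Longrightarrow> P E \<Longrightarrow> Q E"
  shows "prb A p P \<le> prb A p Q"
  unfolding prb_def using assms by (intro expect_mono) auto

lemma prb_disj_le:
  assumes "0 \<le> p" "p \<le> 1"
  shows "prb A p (\<lambda>E. P E \<or> Q E) \<le> prb A p P + prb A p Q"
  unfolding prb_def expect_add[symmetric] using assms by (intro expect_mono) auto

lemma prb_Bex_le:
  assumes "0 \<le> p" "p \<le> 1" "finite I"
  shows "prb A p (\<lambda>E. \<exists>i\<in>I. P i E) \<le> (\<Sum>i\<in>I. prb A p (P i))"
  unfolding prb_def expect_sum[symmetric]
proof (intro expect_mono assms)
  fix E
  show "of_bool (\<exists>i\<in>I. P i E) \<le> (\<Sum>i\<in>I. of_bool (P i E) :: real)"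
  proof (cases "\<exists>i\<in>I. P i E")
    case True
    then obtain i where i: "i \<in> I" "P i E" by auto
    have "(of_bool (P i E) :: real) \<le> (\<Sum>i\<in>I. of_bool (P i E))"
      using i assms(3) by (intro member_le_sum) auto
    then show ?thesis using i True by simp
  qed (auto intro: sum_nonneg)
qed

lemma prb_Not:
  assumes "finite A"
  shows "prb A p (\<lambda>E. \<not> P E) = 1 - prb A p P"
proof -
  have "prb A p (\<lambda>E. \<not> P E) + prb A p P = expect A p (\<lambda>_. 1)"
    unfolding prb_def expect_add[symmetric] by (intro expect_cong) auto
  then show ?thesis using assms by simp
qed

lemma prb_nonneg: "0 \<le> p \<Longrightarrow> p \<le> 1 \<Longrightarrow> 0 \<le> prb A p P"
  unfolding prb_def by (intro expect_nonneg) auto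

lemma prb_le_expect:
  assumes "0 \<le> p" "p \<le> 1" "0 < c" "\<And>E. E \<subseteq> A \<Longrightarrow> 0 \<le> f E" "\<And>E. E \<subseteq> A \<Longrightarrow> P E \<Longrightarrow> c \<le> f E"
  shows "prb A p P \<le> expect A p f / c"
proof -
  have "prb A p P * c = expect A p (\<lambda>E. of_bool (P E) * c)"
    by (simp add: prb_def expect_cmult_right)
  also have "\<dots> \<le> expect A p f" using assms by (intro expect_mono) auto
  finally show ?thesis using assms(3) by (simp add: field_simps)
qed

section \<open>Hall matchings and the pursuit strategy\<close>

text \<open>A set \<open>Y\<close> without surplus can be deleted together with its whole
  neighbourhood: apply Hall's condition to \<open>S \<union> Y\<close> and subtract.\<close>

lemma hall_condition_restrict:
  fixes R :: "'a \<Rightarrow> 'b set"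
  assumes finR: "\<And>x. x \<in> X \<Longrightarrow> finite (R x)" and fin: "finite X"
    and hall: "\<And>S. S \<subseteq> X \<Longrightarrow> card S \<le> card (\<Union> (R ` S))"
    and Y: "Y \<subseteq> X" "card (\<Union> (R ` Y)) \<le> card Y" and S: "S \<subseteq> X - Y"
  shows "card S \<le> card (\<Union>x\<in>S. R x - \<Union> (R ` Y))"
proof -
  have f: "finite Y" "finite S" using Y(1) S fin by (meson finite_subset finite_Diff)+
  have f2: "finite (\<Union> (R ` Y))" "finite (\<Union>x\<in>S. R x - \<Union> (R ` Y))"
    using f Y S finR by (intro finite_UN_I finite_Diff; blast)+
  have "card S + card Y = card (S \<union> Y)"
    using f S by (intro card_Un_disjoint[symmetric]) auto
  also have "\<dots> \<le> card (\<Union> (R ` (S \<union> Y)))" using S Y by (intro hall) auto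
  also have "\<Union> (R ` (S \<union> Y)) = (\<Union>x\<in>S. R x - \<Union> (R ` Y)) \<union> \<Union> (R ` Y)" by auto
  also have "card \<dots> = card (\<Union>x\<in>S. R x - \<Union> (R ` Y)) + card (\<Union> (R ` Y))"
    using f2 by (intro card_Un_disjoint) auto
  finally show ?thesis using Y(2) by linarith
qed

text \<open>The Halmos-Vaughan induction. If some proper nonempty subset is tight, it and its
  complement are matched separately; otherwise every such subset has a spare neighbour and survives
  the loss of the one partner \<open>b\<close> given to \<open>a\<close>.\<close>

theorem hall_marriage:
  fixes R :: "'a \<Rightarrow> 'b set"
  assumes "finite X" and "\<And>x. x \<in> X \<Longrightarrow> finite (R x)"
    and "\<And>S. S \<subseteq> X \<Longrightarrow> card S \<le> card (\<Union> (R ` S))"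
  shows "\<exists>f. inj_on f X \<and> (\<forall>x\<in>X. f x \<in> R x)"
  using assms
proof (induction "card X" arbitrary: X R rule: less_induct)
  case less
  note fin = less.prems(1) and finR = less.prems(2) and hall = less.prems(3)
  show ?case
  proof (cases "X = {}")
    case False
    then obtain a where a: "a \<in> X" by auto
    have "card {a} \<le> card (R a)" using hall[of "{a}"] a by simp
    then have "R a \<noteq> {}" by auto
    then obtain b where b: "b \<in> R a" by auto
    show ?thesis
    proof (cases "\<exists>Y. Y \<subset> X \<and> Y \<noteq> {} \<and> card (\<Union> (R ` Y)) \<le> card Y")
      case True
      then obtain Y where Y: "Y \<subset> X" "Y \<noteq> {}" "card (\<Union> (R ` Y)) \<le> card Y" by auto
      let ?R' = "\<lambda>x. R x - \<Union> (R ` Y)"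
      have fY: "finite Y" using Y(1) fin by (meson finite_subset psubset_imp_subset)
      have lt: "card Y < card X" "card (X - Y) < card X"
        using Y fin by (intro psubset_card_mono; blast)+
      have "\<exists>f. inj_on f Y \<and> (\<forall>x\<in>Y. f x \<in> R x)"
        by (rule less.hyps[OF lt(1) fY]) (use Y(1) finR hall in blast)+
      then obtain f where f: "inj_on f Y" "\<forall>x\<in>Y. f x \<in> R x" by auto
      have "\<exists>g. inj_on g (X - Y) \<and> (\<forall>x\<in>X - Y. g x \<in> ?R' x)"
      proof (rule less.hyps[OF lt(2)])
        show "card S \<le> card (\<Union> (?R' ` S))" if "S \<subseteq> X - Y" for S
          by (rule hall_condition_restrict[OF finR fin hall _ Y(3) that]) (use Y(1) in blast)+
      qed (use fin finR in auto)
      then obtain g where g: "inj_on g (X - Y)" "\<forall>x\<in>X - Y. g x \<in> ?R' x" by auto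
      let ?h = "\<lambda>x. if x \<in> Y then f x else g x"
      have sep: "f x \<noteq> g y" if "x \<in> Y" "y \<in> X - Y" for x y
      proof -
        have fx: "f x \<in> \<Union> (R ` Y)" using f(2) that(1) by auto
        have "g y \<in> R y - \<Union> (R ` Y)" using g(2) that(2) by (rule bspec)
        then have "g y \<notin> \<Union> (R ` Y)" by simp
        with fx show "f x \<noteq> g y" by metis
      qed
      have "inj_on ?h X"
      proof (rule inj_onI)
        fix x y assume xy: "x \<in> X" "y \<in> X" "?h x = ?h y"
        have "x \<in> Y \<longleftrightarrow> y \<in> Y"
          using xy sep[of x y] sep[of y x] by (cases "x \<in> Y"; cases "y \<in> Y") simp_all
        then consider "x \<in> Y" "y \<in> Y" | "x \<in> X - Y" "y \<in> X - Y" using xy(1,2) by auto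
        then show "x = y"
        proof cases
          case 1
          then show ?thesis using xy(3) inj_onD[OF f(1)] by simp
        next
          case 2
          then show ?thesis using xy(3) inj_onD[OF g(1)] by simp
        qed
      qed
      moreover have "?h x \<in> R x" if "x \<in> X" for x
        using bspec[OF f(2), of x] bspec[OF g(2), of x] that by (cases "x \<in> Y") simp_all
      ultimately show ?thesis by (intro exI[of _ ?h] conjI ballI)
    next
      case no: False
      let ?R' = "\<lambda>x. R x - {b}"
      have "\<exists>g. inj_on g (X - {a}) \<and> (\<forall>x\<in>X - {a}. g x \<in> ?R' x)"
      proof (rule less.hyps)
        show "card (X - {a}) < card X" using a fin by (simp add: card_gt_0_iff False)
        fix S assume S: "S \<subseteq> X - {a}"
        show "card S \<le> card (\<Union> (?R' ` S))"
        proof (cases "S = {}")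
          case False
          have "S \<subset> X" using S a by auto
          then have "\<not> card (\<Union> (R ` S)) \<le> card S" using no False by auto
          moreover have "card (\<Union> (R ` S)) \<le> card (\<Union> (R ` S) - {b}) + 1"
            using card_Diff_singleton_if[of "\<Union> (R ` S)" b] by (auto split: if_splits)
          moreover have eq: "\<Union> (?R' ` S) = \<Union> (R ` S) - {b}" by auto
          ultimately show ?thesis unfolding eq by linarith
        qed auto
      qed (use fin finR in auto)
      then obtain g where g: "inj_on g (X - {a})" "\<forall>x\<in>X - {a}. g x \<in> ?R' x" by auto
      let ?h = "g(a := b)"
      have "b \<notin> g ` (X - {a})" using g(2) by auto
      moreover have "inj_on ?h (X - {a})"
        using g(1) inj_on_cong[of "X - {a}" ?h g] by simp
      ultimately have "inj_on ?h (insert a (X - {a}))" unfolding inj_on_insert by auto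
      then have "inj_on ?h X" using a by (simp add: insert_absorb)
      moreover have "?h x \<in> R x" if "x \<in> X" for x
        using bspec[OF g(2), of x] b that by (cases "x = a") simp_all
      ultimately show ?thesis by (intro exI[of _ ?h] conjI ballI)
    qed
  next
    case True
    then show ?thesis by simp
  qed
qed

text \<open>For each robber start, the cops commit to a schedule that ignores the robber's later moves.\<close>

lemma cop_wins_schedule:
  assumes "\<And>t. length (pos t) = k"
    and "\<And>t i. i < k \<Longrightarrow> step_ok E (pos t ! i) (pos (Suc t) ! i)"
    and "\<And>w. w 0 = r \<Longrightarrow> (\<And>i. i < T \<Longrightarrow> step_ok E (w i) (w (Suc i))) \<Longrightarrow>
          \<exists>m\<le>T. w m \<in> set (pos m) \<union> set (pos (Suc m))"
  shows "cop_wins E True (pos 0) r"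
  using assms
proof (induction T arbitrary: pos r)
  case (0 pos r)
  have "r \<in> set (pos 0) \<union> set (pos (Suc 0))"
    using "0.prems"(3)[of "\<lambda>_. r"] by simp
  then consider "r \<in> set (pos 0)" | "r \<in> set (pos 1)" by auto
  then show ?case
  proof cases
    case 2
    show ?thesis
      by (rule cops_move[of "pos 1"]) (use 2 0 in \<open>auto intro: caught\<close>)
  qed (rule caught)
next
  case (Suc T pos r)
  have "cop_wins E False (pos 1) r" if nr: "r \<notin> set (pos 0)" "r \<notin> set (pos 1)"
  proof (rule robber_move, intro allI impI)
    fix r' assume r': "step_ok E r r'"
    have "cop_wins E True ((\<lambda>t. pos (Suc t)) 0) r'"
    proof (rule Suc.IH)
      show "length (pos (Suc t)) = k" for t using Suc.prems(1) by simp
      show "i < k \<Longrightarrow> step_ok E (pos (Suc t) ! i) (pos (Suc (Suc t)) ! i)" for t i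
        using Suc.prems(2) by simp
      fix w :: "nat \<Rightarrow> nat" assume w: "w 0 = r'" "\<And>i. i < T \<Longrightarrow> step_ok E (w i) (w (Suc i))"
      \<comment> \<open>The old robber position is put in front of the remaining walk. A hit at time
        0 is excluded by \<open>nr\<close>, so the hit lies in the tail, where the shifted schedule
        sees it.\<close>
      let ?w = "case_nat r w"
      have "\<exists>m\<le>Suc T. ?w m \<in> set (pos m) \<union> set (pos (Suc m))"
      proof (rule Suc.prems(3))
        fix i assume "i < Suc T"
        then show "step_ok E (?w i) (?w (Suc i))" using w r' by (cases i) auto
      qed simp
      then obtain m where m: "m \<le> Suc T" "?w m \<in> set (pos m) \<union> set (pos (Suc m))" by auto
      then obtain m' where "m = Suc m'" using nr by (cases m) auto
      then show "\<exists>m\<le>T. w m \<in> set (pos (Suc m)) \<union> set (pos (Suc (Suc m)))"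
        using m by auto
    qed
    then show "cop_wins E True (pos 1) r'" by simp
  qed
  then have "cop_wins E False (pos 1) r" if "r \<notin> set (pos 0)"
    using that by (cases "r \<in> set (pos 1)") (auto intro: caught)
  moreover have "cop_wins E True (pos 0) r" if "cop_wins E False (pos 1) r"
    by (rule cops_move[of "pos 1"]) (use that Suc.prems(1,2) in auto)
  ultimately show ?case
    by (cases "r \<in> set (pos 0)") (auto intro: caught)
qed

section \<open>Closed balls and walks of the cops\<close>

definition lazy_step :: "nat set set \<Rightarrow> (nat \<times> nat) set" where
  "lazy_step E = {(x, y). step_ok E x y}"

text \<open>Since a step may stand still, this is the closed ball of radius \<open>j\<close> around
  \<open>S\<close> and not the set of ends of walks of length exactly \<open>j\<close>.\<close>

definition reach :: "nat set set \<Rightarrow> nat \<Rightarrow> nat set \<Rightarrow> nat set" where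
  "reach E j S = (lazy_step E ^^ j) `` S"

lemma lazy_step_sym: "(x, y) \<in> lazy_step E \<Longrightarrow> (y, x) \<in> lazy_step E"
  by (auto simp: lazy_step_def step_ok_def insert_commute)

lemma lazy_step_refl [simp]: "(x, x) \<in> lazy_step E"
  by (simp add: lazy_step_def step_ok_def)

lemma relpow_lazy_step_sym: "(x, y) \<in> lazy_step E ^^ j \<Longrightarrow> (y, x) \<in> lazy_step E ^^ j"
proof (induction j arbitrary: y)
  case (Suc j)
  then obtain z where "(x, z) \<in> lazy_step E ^^ j" "(z, y) \<in> lazy_step E" by auto
  then show ?case by (intro relpow_Suc_I2[OF lazy_step_sym Suc.IH])
qed auto

lemma reach_0 [simp]: "reach E 0 S = S"
  by (simp add: reach_def)

lemma reach_Suc: "reach E (Suc j) S = lazy_step E `` reach E j S"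
  unfolding reach_def by (auto simp: relcomp_Image)

lemma reach_UN: "reach E j S = (\<Union>u\<in>S. reach E j {u})"
  unfolding reach_def by auto

lemma reach_mono: "S \<subseteq> S' \<Longrightarrow> reach E j S \<subseteq> reach E j S'"
  unfolding reach_def by auto

lemma subset_reach: "S \<subseteq> reach E j S"
  by (induction j) (auto simp: reach_Suc intro: ImageI[OF lazy_step_refl])

lemma reach_subset_V:
  assumes "E \<subseteq> all_edges n" "S \<subseteq> {1..n}"
  shows "reach E j S \<subseteq> {1..n}"
proof (induction j)
  case (Suc j)
  have "y \<in> {1..n}" if "x \<in> {1..n}" "step_ok E x y" for x y
    using that assms(1) unfolding step_ok_def all_edges_def
    by (auto simp: doubleton_eq_iff dest!: subsetD)
  then show ?case using Suc unfolding reach_Suc lazy_step_def by blast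
qed (use assms in auto)

lemma finite_reach:
  assumes "E \<subseteq> all_edges n" "S \<subseteq> {1..n}"
  shows "finite (reach E j S)"
  using reach_subset_V[OF assms] by (rule finite_subset) simp

text \<open>\<open>f u\<close> is the cop sent to \<open>u\<close>; injectivity gives each cop at
  most one target. Lazy steps are reversible, so a cop in the ball around \<open>u\<close> can walk
  to \<open>u\<close>; he then freezes there, and cops without a target never move.\<close>

lemma team_schedule:
  assumes inj: "inj_on f X" and f: "\<And>u. u \<in> X \<Longrightarrow> f u \<in> C \<inter> reach E j {u}"
  shows "\<exists>P. (\<forall>c. P c 0 = c) \<and> (\<forall>c t. step_ok E (P c t) (P c (Suc t))) \<and>
          (\<forall>u\<in>X. \<exists>c\<in>C. P c j = u)"
proof -
  have "\<exists>p. p 0 = c \<and> (\<forall>t. step_ok E (p t) (p (Suc t))) \<and> (\<forall>u\<in>X. f u = c \<longrightarrow> p j = u)" for c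
  proof (cases "c \<in> f ` X")
    case True
    then obtain u where u: "u \<in> X" "f u = c" by auto
    have "(c, u) \<in> lazy_step E ^^ j"
      using f[OF u(1)] u(2) relpow_lazy_step_sym unfolding reach_def by auto
    then obtain q where q: "q 0 = c" "q j = u" "\<And>i. i < j \<Longrightarrow> (q i, q (Suc i)) \<in> lazy_step E"
      unfolding relpow_fun_conv by auto
    have "step_ok E (q (min t j)) (q (min (Suc t) j))" for t
      using q(3)[of t] by (cases "t < j") (auto simp: lazy_step_def min_def step_ok_def)
    moreover have "u' = u" if "u' \<in> X" "f u' = c" for u'
      using that u inj by (auto simp: inj_on_def)
    ultimately show ?thesis using q by (intro exI[of _ "\<lambda>t. q (min t j)"]) auto
  next
    case False
    then show ?thesis by (intro exI[of _ "\<lambda>_. c"]) (auto simp: step_ok_def)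
  qed
  then obtain P where P: "\<And>c. P c 0 = c \<and> (\<forall>t. step_ok E (P c t) (P c (Suc t))) \<and>
      (\<forall>u\<in>X. f u = c \<longrightarrow> P c j = u)"
    by metis
  show ?thesis
    by (rule exI[of _ P]) (use P f in blast)
qed

text \<open>\<open>U\<close> collects the vertices near \<open>v\<close> that the first team cannot reach in time; it is chosen as a
  maximal set violating Hall's condition, so that the rest can be matched to the remaining cops.\<close>

lemma two_team_capture:
  fixes n :: nat
  assumes E: "E \<subseteq> all_edges n" and Z: "Z \<subseteq> {1..n}" and C: "C \<subseteq> {1..n}"
    and team1: "\<And>v S. v \<in> {1..n} \<Longrightarrow> S \<subseteq> reach E r {v} - Z \<Longrightarrow> card S = s1 \<Longrightarrow>
        card (reach E r {v}) < card (C \<inter> reach E (Suc r) S)"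
    and team2: "\<And>S. S \<subseteq> {1..n} - Z \<Longrightarrow> card S \<le> M \<Longrightarrow>
        card S \<le> card (C \<inter> reach E (Suc (Suc r)) S)"
    and nb: "\<And>v. v \<in> {1..n} \<Longrightarrow> card (reach E 1 {v}) \<le> D"
    and M: "s1 * D \<le> M"
  shows "cop_number {1..n} E \<le> card Z + 2 * card C"
proof -
  have finZ: "finite Z" and finC: "finite C" using Z C by (auto intro: finite_subset)
  obtain zs where zs: "set zs = Z" "length zs = card Z"
    using finite_distinct_list[OF finZ] distinct_card by metis
  obtain cl where cl: "set cl = C" "length cl = card C"
    using finite_distinct_list[OF finC] distinct_card by metis
  have win: "cop_wins E True (zs @ cl @ cl) v" if v: "v \<in> {1..n}" for v
  proof -
    define T where "T = reach E r {v} - Z"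
    have T: "T \<subseteq> {1..n}" "finite T"
      using reach_subset_V[OF E, of "{v}"] v unfolding T_def by (auto intro: finite_subset)
    define N where "N S = C \<inter> reach E (Suc r) S" for S
    have N_mono: "N S \<subseteq> N S'" if "S \<subseteq> S'" for S S'
      unfolding N_def using reach_mono[OF that] by blast
    have finN: "finite (N S)" for S using finC by (auto simp: N_def)
    have N_UN: "N S = (\<Union>u\<in>S. N {u})" for S unfolding N_def using reach_UN by blast
    \<comment> \<open>Weak violators, with \<open>\<le>\<close> and not \<open><\<close>: the empty
      set is then one, and a maximal one cannot be enlarged by a strict violator disjoint from it.
      This yields Hall's condition on \<open>T - U\<close>.\<close>
    define VS where "VS = {S. S \<subseteq> T \<and> card (N S) \<le> card S}"
    have "finite VS" using T unfolding VS_def by simp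
    moreover have "{} \<in> VS" by (simp add: VS_def N_def reach_def)
    ultimately obtain U where U: "U \<in> VS" "\<And>S. S \<in> VS \<Longrightarrow> U \<subseteq> S \<Longrightarrow> S = U"
      using finite_has_maximal[of VS] by blast
    have U': "U \<subseteq> T" "card (N U) \<le> card U" "finite U"
      using U(1) T by (auto simp: VS_def intro: finite_subset)
    \<comment> \<open>Otherwise \<open>U\<close> contains a set of \<open>s1\<close> vertices whose
      reachable cops already outnumber the whole ball, hence also \<open>U\<close>.\<close>
    have "card U < s1"
    proof (rule ccontr)
      assume "\<not> card U < s1"
      then obtain S where S: "S \<subseteq> U" "card S = s1"
        using obtain_subset_with_card_n[of s1 U] by auto
      have "card (reach E r {v}) < card (N S)"
        unfolding N_def using S U' by (intro team1[OF v]) (auto simp: T_def)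
      also have "\<dots> \<le> card (N U)" 
        by (intro card_mono finN N_mono S(1))
      also have "\<dots> \<le> card U" by (rule U')
      also have "\<dots> \<le> card (reach E r {v})"
        by (rule card_mono) (use U'(1) finite_reach[OF E, of "{v}" r] v in \<open>auto simp: T_def\<close>)
      finally show False by simp
    qed
    \<comment> \<open>A robber who stands in \<open>U\<close> after \<open>r\<close> moves is in the
      closed neighbourhood of \<open>U\<close> one move later; the part outside \<open>Z\<close> is
      what the second team must fill.\<close>
    define T2 where "T2 = reach E 1 U - Z"
    have T2V: "T2 \<subseteq> {1..n} - Z" "finite T2"
      using reach_subset_V[OF E, of U] U'(1) T unfolding T2_def by (auto intro: finite_subset)
    have "card (reach E 1 U) \<le> (\<Sum>u\<in>U. card (reach E 1 {u}))"
      by (subst reach_UN) (rule card_UN_le[OF U'(3)])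
    also have "\<dots> \<le> (\<Sum>u\<in>U. D)" using U'(1) T by (intro sum_mono nb) auto
    also have "\<dots> \<le> s1 * D" using \<open>card U < s1\<close> by simp
    finally have "card (reach E 1 U) \<le> M" using M by linarith
    moreover have "card T2 \<le> card (reach E 1 U)"
      unfolding T2_def using finite_reach[OF E, of U 1] U'(1) T by (intro card_mono) auto
    ultimately have cT2: "card T2 \<le> M" by linarith
    have "\<exists>f. inj_on f (T - U) \<and> (\<forall>u\<in>T - U. f u \<in> N {u})"
    proof (rule hall_marriage)
      fix S assume S: "S \<subseteq> T - U"
      show "card S \<le> card (\<Union>u\<in>S. N {u})"
      proof (rule ccontr)
        assume "\<not> ?thesis"
        then have lt: "card (N S) < card S" using N_UN[of S] by simp
        have fS: "finite S" using S T by (auto intro: finite_subset)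
        have "card (N (U \<union> S)) \<le> card (N U) + card (N S)"
        proof -
          have "N (U \<union> S) = N U \<union> N S" unfolding N_def reach_def by auto
          then show ?thesis by (simp add: card_Un_le)
        qed
        also have "\<dots> < card U + card S" using lt U' by linarith
        also have "\<dots> = card (U \<union> S)" using S fS U' by (intro card_Un_disjoint[symmetric]) auto
        finally have "U \<union> S \<in> VS" using S U' by (auto simp: VS_def)
        then have "U \<union> S = U" using U(2) by blast
        then have "S = {}" using S by auto
        then show False using lt by simp
      qed
    qed (use T finN in auto)
    then obtain f where f: "inj_on f (T - U)" "\<forall>u\<in>T - U. f u \<in> N {u}" by auto
    have "\<exists>g. inj_on g T2 \<and> (\<forall>u\<in>T2. g u \<in> C \<inter> reach E (Suc (Suc r)) {u})"
    proof (rule hall_marriage)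
      fix S assume S: "S \<subseteq> T2"
      have "card S \<le> card (C \<inter> reach E (Suc (Suc r)) S)"
        using S T2V cT2 card_mono[OF T2V(2) S] by (intro team2) auto
      also have "C \<inter> reach E (Suc (Suc r)) S = (\<Union>u\<in>S. C \<inter> reach E (Suc (Suc r)) {u})"
        using reach_UN by blast
      finally show "card S \<le> card (\<Union>u\<in>S. C \<inter> reach E (Suc (Suc r)) {u})" .
    qed (use T2V finC in auto)
    then obtain g where g: "inj_on g T2" "\<forall>u\<in>T2. g u \<in> C \<inter> reach E (Suc (Suc r)) {u}" by auto
    have "\<exists>P. (\<forall>c. P c 0 = c) \<and> (\<forall>c t. step_ok E (P c t) (P c (Suc t))) \<and>
        (\<forall>u\<in>T - U. \<exists>c\<in>C. P c (Suc r) = u)"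
      by (rule team_schedule[OF f(1)]) (use f(2) in \<open>auto simp: N_def\<close>)
    then obtain P where "\<forall>c. P c 0 = c" "\<forall>c t. step_ok E (P c t) (P c (Suc t))"
      "\<forall>u\<in>T - U. \<exists>c\<in>C. P c (Suc r) = u"
      by (elim exE conjE)
    note P = this[rule_format]
    have "\<exists>Q. (\<forall>c. Q c 0 = c) \<and> (\<forall>c t. step_ok E (Q c t) (Q c (Suc t))) \<and>
        (\<forall>u\<in>T2. \<exists>c\<in>C. Q c (Suc (Suc r)) = u)"
      by (rule team_schedule[OF g(1)]) (use g(2) in \<open>auto simp: N_def\<close>)
    then obtain Q where "\<forall>c. Q c 0 = c" "\<forall>c t. step_ok E (Q c t) (Q c (Suc t))"
      "\<forall>u\<in>T2. \<exists>c\<in>C. Q c (Suc (Suc r)) = u"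
      by (elim exE conjE)
    note Q = this[rule_format]
    \<comment> \<open>Both teams start on the same vertices \<open>cl\<close>, hence the term
      \<open>2 * card C\<close>.\<close>
    define pos where "pos t = zs @ map (\<lambda>c. P c t) cl @ map (\<lambda>c. Q c t) cl" for t
    have pos0: "pos 0 = zs @ cl @ cl" using P(1) Q(1) by (simp add: pos_def)
    have "cop_wins E True (pos 0) v"
    proof (rule cop_wins_schedule)
      show "length (pos t) = length zs + 2 * length cl" for t by (simp add: pos_def)
      show "step_ok E (pos t ! i) (pos (Suc t) ! i)" if "i < length zs + 2 * length cl" for t i
        using that P(2) Q(2) by (auto simp: pos_def nth_append step_ok_def[of E "zs ! i"])
      fix w :: "nat \<Rightarrow> nat"
      assume w: "w 0 = v" "\<And>i. i < Suc r \<Longrightarrow> step_ok E (w i) (w (Suc i))"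
      have "(v, w r) \<in> lazy_step E ^^ r"
        unfolding relpow_fun_conv by (rule exI[of _ w]) (use w in \<open>auto simp: lazy_step_def\<close>)
      then have wr: "w r \<in> reach E r {v}" by (simp add: reach_def)
      consider "w r \<in> Z" | "w r \<in> T - U" | "w r \<in> U" using wr unfolding T_def by auto
      then show "\<exists>m\<le>Suc r. w m \<in> set (pos m) \<union> set (pos (Suc m))"
      proof cases
        case 1
        then show ?thesis using zs by (intro exI[of _ r]) (simp add: pos_def)
      next
        case 2
        \<comment> \<open>Arrival at time \<open>Suc r\<close> answers the robber's position at time
          \<open>r\<close>: the capture takes place on the cops' own move.\<close>
        obtain c where c: "c \<in> C" "P c (Suc r) = w r" using P(3)[OF 2] by (elim bexE)
        have "P c (Suc r) \<in> set (pos (Suc r))" using c(1) cl(1) by (simp add: pos_def)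
        then show ?thesis unfolding c(2) by (intro exI[of _ r]) simp
      next
        case 3
        then have "w (Suc r) \<in> reach E 1 U"
          using w(2)[of r] by (auto simp: reach_def lazy_step_def)
        then consider "w (Suc r) \<in> Z" | "w (Suc r) \<in> T2" unfolding T2_def by auto
        then show ?thesis
        proof cases
          case 1
          then show ?thesis using zs by (intro exI[of _ "Suc r"]) (simp add: pos_def)
        next
          case 2
          obtain c where c: "c \<in> C" "Q c (Suc (Suc r)) = w (Suc r)" using Q(3)[OF 2] by (elim bexE)
          have "Q c (Suc (Suc r)) \<in> set (pos (Suc (Suc r)))" using c(1) cl(1) by (simp add: pos_def)
          then show ?thesis unfolding c(2) by (intro exI[of _ "Suc r"]) simp
        qed
      qed
    qed
    then show ?thesis using pos0 by simp
  qed
  have "cops_win {1..n} E (card Z + 2 * card C)"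
    unfolding cops_win_def by (rule exI[of _ "zs @ cl @ cl"]) (use zs cl Z C win in auto)
  then show ?thesis unfolding cop_number_def by (rule Least_le)
qed

section \<open>Breadth-first search in the random graph\<close>

definition nbrs :: "nat \<Rightarrow> nat set set \<Rightarrow> nat set \<Rightarrow> nat set \<Rightarrow> nat set" where
  "nbrs n E A Y = {w \<in> {1..n} - Y. \<exists>a\<in>A. {a, w} \<in> E}"

definition meeting :: "nat \<Rightarrow> nat set \<Rightarrow> nat set set" where
  "meeting n X = {e \<in> all_edges n. e \<inter> X \<noteq> {}}"

text \<open>The processed vertices, all of whose edges have been inspected: the ball of radius
  \<open>i - 1\<close>, and the empty set for \<open>i = 0\<close>, so that the layer of index 0 is
  \<open>S\<close> itself.\<close>

definition inner :: "nat set set \<Rightarrow> nat set \<Rightarrow> nat \<Rightarrow> nat set" where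
  "inner E S i = (case i of 0 \<Rightarrow> {} | Suc k \<Rightarrow> reach E k S)"

definition layer :: "nat set set \<Rightarrow> nat set \<Rightarrow> nat \<Rightarrow> nat set" where
  "layer E S i = reach E i S - inner E S i"

lemma all_edges_subset_Pow: "all_edges n \<subseteq> Pow {1..n}"
  by (auto simp: all_edges_def)

lemma finite_all_edges [simp]: "finite (all_edges n)"
  by (rule finite_subset[OF all_edges_subset_Pow]) simp

lemma doubleton_in_all_edges:
  "{a, b} \<in> all_edges n \<longleftrightarrow> a \<noteq> b \<and> a \<in> {1..n} \<and> b \<in> {1..n}"
  by (auto simp: all_edges_def doubleton_eq_iff)

lemma finite_nbrs [simp]: "finite (nbrs n E A Y)"
  by (rule finite_subset[of _ "{1..n}"]) (auto simp: nbrs_def)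

text \<open>Each vertex outside \<open>Y\<close> is joined to \<open>A\<close> with probability
  \<open>1 - (1 - p) ^ card A\<close>, and the edge sets from \<open>A\<close> to different such
  vertices are disjoint. So the count is binomial.\<close>

lemma expect_power_nbrs:
  assumes "A \<subseteq> Y" "Y \<subseteq> {1..n}"
  shows "expect (all_edges n) p (\<lambda>E. z ^ card (nbrs n E A Y))
       = (1 + (z - 1) * (1 - (1 - p) ^ card A)) ^ (n - card Y)"
proof -
  have fin: "finite A" "finite Y" using assms by (auto intro: finite_subset)
  define F where "F w = (\<lambda>a. {a, w}) ` A" for w
  \<comment> \<open>Because \<open>0 ^ 0 = 1\<close>, this is 1 if no edge of \<open>F w\<close> is
    present and \<open>z\<close> otherwise, in a form that \<open>expect_power_card\<close>
    evaluates at base 0.\<close>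
  define f :: "nat \<Rightarrow> nat set set \<Rightarrow> real" where "f w E = z + (1 - z) * 0 ^ card (E \<inter> F w)" for w E
  have Fsub: "F w \<subseteq> all_edges n" if "w \<in> {1..n} - Y" for w
    using that assms unfolding F_def image_subset_iff doubleton_in_all_edges by blast
  have finF: "finite (F w)" for w using fin by (simp add: F_def)
  have f_if: "f w E = (if w \<in> nbrs n E A Y then z else 1)" if "w \<in> {1..n} - Y" for w E
  proof -
    have "w \<in> nbrs n E A Y \<longleftrightarrow> E \<inter> F w \<noteq> {}" using that by (auto simp: nbrs_def F_def)
    then show ?thesis using finF[of w] by (auto simp: f_def power_0_left)
  qed
  have "z ^ card (nbrs n E A Y) = (\<Prod>w\<in>{1..n} - Y. f w E)" for E
  proof -
    have "(\<Prod>w\<in>{1..n} - Y. f w E) = (\<Prod>w\<in>{1..n} - Y. if w \<in> nbrs n E A Y then z else 1)"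
      by (intro prod.cong refl f_if)
    also have "\<dots> = (\<Prod>w\<in>({1..n} - Y) \<inter> nbrs n E A Y. z)"
      by (subst prod.inter_restrict) auto
    also have "({1..n} - Y) \<inter> nbrs n E A Y = nbrs n E A Y" by (auto simp: nbrs_def)
    finally show ?thesis by simp
  qed
  then have "expect (all_edges n) p (\<lambda>E. z ^ card (nbrs n E A Y))
      = expect (all_edges n) p (\<lambda>E. \<Prod>w\<in>{1..n} - Y. f w E)" by simp
  also have "\<dots> = (\<Prod>w\<in>{1..n} - Y. expect (all_edges n) p (f w))"
  proof (rule expect_prod)
    show "disjoint_family_on F ({1..n} - Y)"
    proof (unfold disjoint_family_on_def, intro ballI impI)
      fix w w' assume w: "w \<in> {1..n} - Y" "w' \<in> {1..n} - Y" "w \<noteq> w'"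
      show "F w \<inter> F w' = {}"
      proof (rule ccontr)
        assume "F w \<inter> F w' \<noteq> {}"
        then obtain a b where "a \<in> A" "b \<in> A" "{a, w} = {b, w'}" by (auto simp: F_def)
        then have "w \<in> A" using w(3) by (auto simp: doubleton_eq_iff)
        then show False using w(1) assms(1) by blast
      qed
    qed
    show "f w (E \<inter> F w) = f w E" for w E by (simp add: f_def Int_assoc)
  qed (use Fsub in auto)
  also have "\<dots> = (\<Prod>w\<in>{1..n} - Y. 1 + (z - 1) * (1 - (1 - p) ^ card A))"
  proof (intro prod.cong refl)
    fix w assume w: "w \<in> {1..n} - Y"
    have "inj_on (\<lambda>a. {a, w}) A"
      using w assms(1) by (intro inj_onI) (auto simp: doubleton_eq_iff)
    then have cF: "card (F w) = card A" by (simp add: F_def card_image)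
    have "expect (all_edges n) p (f w) =
        expect (all_edges n) p (\<lambda>_. z) + (1 - z) * expect (all_edges n) p (\<lambda>E. 0 ^ card (E \<inter> F w))"
      unfolding expect_cmult[symmetric] expect_add[symmetric] by (rule expect_cong) (simp add: f_def)
    also have "\<dots> = z + (1 - z) * (1 - p) ^ card A"
      using Fsub[OF w] cF by (simp add: expect_power_card)
    finally show "expect (all_edges n) p (f w) = 1 + (z - 1) * (1 - (1 - p) ^ card A)"
      by (simp add: algebra_simps)
  qed
  also have "\<dots> = (1 + (z - 1) * (1 - (1 - p) ^ card A)) ^ (n - card Y)"
    using assms fin by (simp add: card_Diff_subset)
  finally show ?thesis .
qed

section \<open>Layers and the information they reveal\<close>

lemma inner_Suc: "inner E S (Suc i) = reach E i S"
  by (simp add: inner_def)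

lemma reach_le_mono: "i \<le> j \<Longrightarrow> reach E i S \<subseteq> reach E j S"
proof (induction j rule: dec_induct)
  case (step k)
  have "reach E k S \<subseteq> reach E (Suc k) S"
    unfolding reach_Suc by (auto intro: ImageI[OF lazy_step_refl])
  then show ?case using step by blast
qed simp

lemma inner_subset_reach: "inner E S i \<subseteq> reach E i S"
  unfolding inner_def by (cases i) (use reach_le_mono[of "i - 1" i] in auto)

lemma inner_Un_layer: "inner E S i \<union> layer E S i = reach E i S"
  using inner_subset_reach by (auto simp: layer_def)

lemma inner_Int_layer: "inner E S i \<inter> layer E S i = {}"
  by (auto simp: layer_def)

text \<open>A new vertex can hang only on the current layer, since neighbours of earlier vertices
  already lie in the ball.\<close>

lemma layer_Suc:
  assumes "E \<subseteq> all_edges n" "S \<subseteq> {1..n}"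
  shows "layer E S (Suc i) = nbrs n E (layer E S i) (reach E i S)"
proof (intro equalityI subsetI)
  fix x assume "x \<in> layer E S (Suc i)"
  then have x: "x \<in> reach E (Suc i) S" "x \<notin> reach E i S" by (auto simp: layer_def inner_Suc)
  then obtain y where y: "y \<in> reach E i S" "step_ok E y x"
    by (auto simp: reach_Suc lazy_step_def)
  then have e: "{y, x} \<in> E" using x by (auto simp: step_ok_def)
  have "y \<notin> inner E S i"
  proof
    assume "y \<in> inner E S i"
    then obtain k where k: "i = Suc k" "y \<in> reach E k S" by (cases i) (auto simp: inner_def)
    then have "x \<in> reach E (Suc k) S" using y by (auto simp: reach_Suc lazy_step_def)
    then show False using x k by simp
  qed
  then have "y \<in> layer E S i" using y by (simp add: layer_def)
  moreover have "x \<in> {1..n}" using x reach_subset_V[OF assms] by blast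
  ultimately show "x \<in> nbrs n E (layer E S i) (reach E i S)" using x e by (auto simp: nbrs_def)
next
  fix x assume "x \<in> nbrs n E (layer E S i) (reach E i S)"
  then obtain a where a: "x \<notin> reach E i S" "a \<in> reach E i S" "{a, x} \<in> E"
    by (auto simp: nbrs_def layer_def)
  then have "x \<in> reach E (Suc i) S" by (auto simp: reach_Suc lazy_step_def step_ok_def)
  then show "x \<in> layer E S (Suc i)" using a by (simp add: layer_def inner_Suc)
qed

text \<open>Growing a ball from radius \<open>k\<close> to \<open>Suc k\<close> inspects only edges
  that meet the smaller ball. The hypothesis mentions the ball of \<open>E\<close> alone; that
  \<open>E'\<close> has the same one is part of the induction.\<close>

lemma reach_local:
  assumes E: "E \<subseteq> all_edges n" "E' \<subseteq> all_edges n"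
    and eq: "E \<inter> meeting n (inner E S i) = E' \<inter> meeting n (inner E S i)" and "k \<le> i"
  shows "reach E' k S = reach E k S"
  using \<open>k \<le> i\<close>
proof (induction k)
  case (Suc k)
  then have IH: "reach E' k S = reach E k S" by simp
  obtain j where j: "i = Suc j" "k \<le> j" using Suc.prems by (cases i) auto
  have sub: "reach E k S \<subseteq> inner E S i" using reach_le_mono[OF j(2)] j by (simp add: inner_Suc)
  have "{x, y} \<in> E \<longleftrightarrow> {x, y} \<in> E'" if x: "x \<in> reach E k S" for x y
  proof -
    have "x \<in> inner E S i" using x sub by blast
    then have m: "e \<in> meeting n (inner E S i)" if "e = {x, y}" "e \<in> all_edges n" for e
      using that by (auto simp: meeting_def)
    show ?thesis
    proof
      assume "{x, y} \<in> E"
      then have "{x, y} \<in> E \<inter> meeting n (inner E S i)" using E m by blast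
      then show "{x, y} \<in> E'" unfolding eq by blast
    next
      assume "{x, y} \<in> E'"
      then have "{x, y} \<in> E' \<inter> meeting n (inner E S i)" using E m by blast
      then show "{x, y} \<in> E" unfolding eq[symmetric] by blast
    qed
  qed
  then show ?case unfolding reach_Suc IH by (auto simp: lazy_step_def step_ok_def)
qed simp

lemma state_local:
  assumes "E \<subseteq> all_edges n" "E' \<subseteq> all_edges n"
    and "E \<inter> meeting n (inner E S i) = E' \<inter> meeting n (inner E S i)"
  shows "inner E' S i = inner E S i" "layer E' S i = layer E S i"
proof -
  show "inner E' S i = inner E S i"
    unfolding inner_def using reach_local[OF assms] by (cases i) auto
  then show "layer E' S i = layer E S i"
    unfolding layer_def using reach_local[OF assms, of i] by simp
qed

text \<open>The information revealed after \<open>i\<close> rounds of breadth-first search consists of the edges that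
  meet the vertices processed so far.\<close>

definition adapted :: "nat \<Rightarrow> nat set \<Rightarrow> nat \<Rightarrow> (nat set set \<Rightarrow> 'b) \<Rightarrow> bool" where
  "adapted n S i g \<longleftrightarrow> (\<forall>E E'. E \<subseteq> all_edges n \<longrightarrow> E' \<subseteq> all_edges n \<longrightarrow>
     E \<inter> meeting n (inner E S i) = E' \<inter> meeting n (inner E S i) \<longrightarrow> g E = g E')"

text \<open>One round of the search read backwards. Given the processed set and the current layer,
  the next layer is binomial and independent of the past, so a weight \<open>z\<close> per vertex on
  it is traded for a weight \<open>u\<close> on the current layer. Since \<open>bound\<close> is
  asked only where \<open>g\<close> is nonzero, \<open>g\<close> can truncate to small
  balls.\<close>

lemma expect_layer_step:
  fixes g :: "nat set set \<Rightarrow> real"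
  assumes S: "S \<subseteq> {1..n}" and p: "0 \<le> p" "p \<le> 1"
    and ad: "adapted n S i g" and g0: "\<And>E. 0 \<le> g E"
    and bound: "\<And>E. E \<subseteq> all_edges n \<Longrightarrow> g E \<noteq> 0 \<Longrightarrow>
        (1 + (z - 1) * (1 - (1 - p) ^ card (layer E S i))) ^ (n - card (reach E i S))
          \<le> u ^ card (layer E S i)"
  shows "expect (all_edges n) p (\<lambda>E. g E * z ^ card (layer E S (Suc i)))
       \<le> expect (all_edges n) p (\<lambda>E. g E * u ^ card (layer E S i))"
proof -
  \<comment> \<open>Conditioning is carried out as a finite sum over all pairs of a processed set
    and a layer.\<close>
  define I where "I = {XA \<in> Pow {1..n} \<times> Pow {1..n}. fst XA \<inter> snd XA = {}}"
  have finI: "finite I" by (simp add: I_def)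
  define st where "st E = (inner E S i, layer E S i)" for E
  define f where "f XA E = of_bool (st E = XA) * g E" for XA E
  have stI: "st E \<in> I" if "E \<subseteq> all_edges n" for E
  proof -
    have "inner E S i \<union> layer E S i \<subseteq> {1..n}"
      unfolding inner_Un_layer by (rule reach_subset_V[OF that S])
    then show ?thesis unfolding I_def st_def using inner_Int_layer by auto
  qed
  have decomp: "g E * h (st E) = (\<Sum>XA\<in>I. f XA E * h XA)" if "E \<subseteq> all_edges n" for E h
  proof -
    have "(\<Sum>XA\<in>I. f XA E * h XA) = (\<Sum>XA\<in>I. if st E = XA then g E * h XA else 0)"
      by (intro sum.cong) (auto simp: f_def)
    then show ?thesis using stI[OF that] finI by (simp add: sum.delta')
  qed
  have lay: "layer E S (Suc i) = nbrs n E (snd (st E)) (fst (st E) \<union> snd (st E))"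
    if "E \<subseteq> all_edges n" for E
    using layer_Suc[OF that S] by (simp add: st_def inner_Un_layer)
  have "expect (all_edges n) p (\<lambda>E. g E * z ^ card (layer E S (Suc i)))
      = expect (all_edges n) p (\<lambda>E. \<Sum>XA\<in>I. f XA E * z ^ card (nbrs n E (snd XA) (fst XA \<union> snd XA)))"
  proof (rule expect_cong)
    fix E assume E: "E \<subseteq> all_edges n"
    show "g E * z ^ card (layer E S (Suc i))
       = (\<Sum>XA\<in>I. f XA E * z ^ card (nbrs n E (snd XA) (fst XA \<union> snd XA)))"
      unfolding lay[OF E] by (rule decomp[OF E])
  qed
  also have "\<dots> = (\<Sum>XA\<in>I. expect (all_edges n) p
      (\<lambda>E. f XA E * z ^ card (nbrs n E (snd XA) (fst XA \<union> snd XA))))"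
    by (rule expect_sum)
  also have "\<dots> \<le> (\<Sum>XA\<in>I. expect (all_edges n) p (\<lambda>E. f XA E * u ^ card (snd XA)))"
  proof (intro sum_mono)
    fix XA assume "XA \<in> I"
    then obtain X A where XA: "XA = (X, A)" "X \<subseteq> {1..n}" "A \<subseteq> {1..n}" "X \<inter> A = {}"
      by (auto simp: I_def)
    have "expect (all_edges n) p (\<lambda>E. f XA E * z ^ card (nbrs n E A (X \<union> A)))
        = expect (all_edges n) p (f XA) * expect (all_edges n) p (\<lambda>E. z ^ card (nbrs n E A (X \<union> A)))"
    \<comment> \<open>The state and \<open>g\<close> depend on edges meeting \<open>X\<close>,
      whereas edges from \<open>A\<close> to vertices outside \<open>X \<union> A\<close> avoid
      \<open>X\<close>.\<close>
    proof (rule expect_indep[of _ "meeting n X"])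
      show "meeting n X \<subseteq> all_edges n" by (auto simp: meeting_def)
      fix E assume E: "E \<subseteq> all_edges n"
      have E': "E \<inter> meeting n X \<subseteq> all_edges n" using E by blast
      show "f XA (E \<inter> meeting n X) = f XA E"
      proof (cases "st E = XA")
        case True
        then have X: "inner E S i = X" by (simp add: st_def XA)
        have eq: "E \<inter> meeting n (inner E S i) = (E \<inter> meeting n X) \<inter> meeting n (inner E S i)"
          unfolding X by blast
        have "st (E \<inter> meeting n X) = st E"
          unfolding st_def using state_local[OF E E' eq] by simp
        moreover have "g (E \<inter> meeting n X) = g E"
          using ad E E' eq unfolding adapted_def by metis
        ultimately show ?thesis by (simp add: f_def)
      next
        \<comment> \<open>Here the restricted graph is the one assumed to have state
          \<open>XA\<close>, so locality is applied with the two graphs exchanged.\<close>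
        case False
        have "st (E \<inter> meeting n X) \<noteq> XA"
        proof
          assume st: "st (E \<inter> meeting n X) = XA"
          then have X: "inner (E \<inter> meeting n X) S i = X" by (simp add: st_def XA)
          have eq: "(E \<inter> meeting n X) \<inter> meeting n (inner (E \<inter> meeting n X) S i)
              = E \<inter> meeting n (inner (E \<inter> meeting n X) S i)"
            unfolding X by blast
          have "st E = XA" using state_local[OF E' E eq] st unfolding st_def by simp
          then show False using False by simp
        qed
        then show ?thesis using False by (simp add: f_def)
      qed
      have "nbrs n (E - meeting n X) A (X \<union> A) = nbrs n E A (X \<union> A)"
        unfolding nbrs_def meeting_def using XA(4) by blast
      then show "z ^ card (nbrs n (E - meeting n X) A (X \<union> A)) = z ^ card (nbrs n E A (X \<union> A))"
        by simp
    qed simp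
    also have "\<dots> = expect (all_edges n) p (f XA) *
        (1 + (z - 1) * (1 - (1 - p) ^ card A)) ^ (n - card (X \<union> A))"
      using XA by (subst expect_power_nbrs) auto
    also have "\<dots> \<le> expect (all_edges n) p (f XA) * u ^ card A"
    proof (cases "\<exists>E. E \<subseteq> all_edges n \<and> f XA E \<noteq> 0")
      case True
      then obtain E where E: "E \<subseteq> all_edges n" "st E = XA" "g E \<noteq> 0" by (auto simp: f_def)
      have "reach E i S = X \<union> A" "layer E S i = A"
        using E(2) inner_Un_layer[of E S i] by (auto simp: st_def XA)
      then have "(1 + (z - 1) * (1 - (1 - p) ^ card A)) ^ (n - card (X \<union> A)) \<le> u ^ card A"
        using bound[OF E(1,3)] by simp
      moreover have "0 \<le> expect (all_edges n) p (f XA)"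
        using p g0 by (intro expect_nonneg) (auto simp: f_def)
      ultimately show ?thesis by (intro mult_left_mono)
    next
      case False
      then have "expect (all_edges n) p (f XA) = expect (all_edges n) p (\<lambda>_. 0)"
        by (intro expect_cong) auto
      then show ?thesis by simp
    qed
    also have "\<dots> = expect (all_edges n) p (\<lambda>E. f XA E * u ^ card A)"
      by (simp add: expect_cmult_right)
    finally show "expect (all_edges n) p (\<lambda>E. f XA E * z ^ card (nbrs n E (snd XA) (fst XA \<union> snd XA)))
      \<le> expect (all_edges n) p (\<lambda>E. f XA E * u ^ card (snd XA))"
      by (simp add: XA)
  qed
  also have "\<dots> = expect (all_edges n) p (\<lambda>E. \<Sum>XA\<in>I. f XA E * u ^ card (snd XA))"
    by (rule expect_sum[symmetric])
  also have "\<dots> = expect (all_edges n) p (\<lambda>E. g E * u ^ card (layer E S i))"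
  proof (rule expect_cong)
    fix E assume E: "E \<subseteq> all_edges n"
    show "(\<Sum>XA\<in>I. f XA E * u ^ card (snd XA)) = g E * u ^ card (layer E S i)"
      using decomp[OF E, of "\<lambda>XA. u ^ card (snd XA)"] by (simp add: st_def)
  qed
  finally show ?thesis .
qed

section \<open>Growth and expansion of balls\<close>

text \<open>Bernoulli's inequality bounds the chance of being hit by \<open>a p\<close>. The outcome
  is an \<open>a\<close>-th power, the shape that \<open>expect_layer_step\<close> wants for
  \<open>u\<close>.\<close>

lemma nbr_factor_le_upper:
  fixes p z :: real
  assumes "0 \<le> p" "p \<le> 1" "1 \<le> z"
  shows "(1 + (z - 1) * (1 - (1 - p) ^ a)) ^ m \<le> exp ((z - 1) * (p * real m)) ^ a"
proof -
  have "1 + real a * (- p) \<le> (1 + (- p)) ^ a" using assms by (intro Bernoulli_inequality) auto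
  then have q: "1 - (1 - p) ^ a \<le> real a * p" by simp
  have q0: "0 \<le> 1 - (1 - p) ^ a" using assms by (simp add: power_le_one)
  have "1 + (z - 1) * (1 - (1 - p) ^ a) \<le> 1 + (z - 1) * (real a * p)"
    using q assms by (intro add_left_mono mult_left_mono) auto
  also have "\<dots> \<le> exp ((z - 1) * (real a * p))" by (rule exp_ge_add_one_self)
  finally have "(1 + (z - 1) * (1 - (1 - p) ^ a)) ^ m \<le> exp ((z - 1) * (real a * p)) ^ m"
    using q0 assms by (intro power_mono) auto
  also have "\<dots> = exp ((z - 1) * (p * real m)) ^ a"
    unfolding exp_of_nat_mult[symmetric] by (simp add: mult_ac)
  finally show ?thesis .
qed

lemma exp_minus_le_quadratic:
  fixes x :: real
  assumes "0 \<le> x"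
  shows "exp (- x) \<le> 1 - x + x\<^sup>2"
proof -
  have "1 + x \<le> exp x" by (rule exp_ge_add_one_self)
  then have "exp (- x) \<le> 1 / (1 + x)" using assms by (simp add: exp_minus field_simps)
  also have "\<dots> \<le> 1 - x + x\<^sup>2"
  proof -
    have "(1 - x + x\<^sup>2) * (1 + x) = 1 + x ^ 3" by (simp add: algebra_simps power2_eq_square power3_eq_cube)
    moreover have "0 \<le> x ^ 3" using assms by simp
    ultimately show ?thesis using assms by (simp add: divide_le_eq)
  qed
  finally show ?thesis .
qed

text \<open>The chance of being hit is at least \<open>p a (1 - p a)\<close>; the last factor is the
  price of vertices hit from several sides.\<close>

lemma nbr_factor_le_lower:
  fixes p z :: real
  assumes "0 \<le> p" "p \<le> 1" "0 \<le> z" "z \<le> 1"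
  shows "(1 + (z - 1) * (1 - (1 - p) ^ a)) ^ m
       \<le> exp (- ((1 - z) * (p * real m * (1 - p * real a)))) ^ a"
proof -
  let ?x = "p * real a"
  have "(1 - p) ^ a \<le> exp (- p) ^ a"
    using assms exp_ge_add_one_self[of "- p"] by (intro power_mono) auto
  also have "\<dots> = exp (- ?x)" unfolding exp_of_nat_mult[symmetric] by (simp add: mult_ac)
  also have "\<dots> \<le> 1 - ?x + ?x\<^sup>2" using assms by (intro exp_minus_le_quadratic) auto
  finally have q: "?x * (1 - ?x) \<le> 1 - (1 - p) ^ a" by (simp add: algebra_simps power2_eq_square)
  have q1: "0 \<le> 1 + (z - 1) * (1 - (1 - p) ^ a)"
  proof -
    have "(1 - z) * (1 - (1 - p) ^ a) \<le> 1 * 1"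
      using assms by (intro mult_mono) (auto simp: power_le_one)
    then show ?thesis by (simp add: algebra_simps)
  qed
  have "(1 - z) * (?x * (1 - ?x)) \<le> (1 - z) * (1 - (1 - p) ^ a)"
    using q assms by (intro mult_left_mono) auto
  then have "1 + (z - 1) * (1 - (1 - p) ^ a) \<le> 1 + - ((1 - z) * (?x * (1 - ?x)))"
    by (simp add: algebra_simps)
  also have "\<dots> \<le> exp (- ((1 - z) * (?x * (1 - ?x))))" by (rule exp_ge_add_one_self)
  finally have "(1 + (z - 1) * (1 - (1 - p) ^ a)) ^ m \<le> exp (- ((1 - z) * (?x * (1 - ?x)))) ^ m"
    using q1 by (intro power_mono) auto
  also have "\<dots> = exp (- ((1 - z) * (p * real m * (1 - ?x)))) ^ a"
    unfolding exp_of_nat_mult[symmetric] by (simp add: mult_ac)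
  finally show ?thesis .
qed

lemma exp_power_mono: "(x::real) \<le> y \<Longrightarrow> exp x ^ k \<le> exp y ^ k"
  by (intro power_mono) auto

locale sparse_gnp =
  fixes n :: nat and d p :: real
  assumes n2: "2 \<le> n" and d4: "4 \<le> d" and p_def: "p = d / (real n - 1)" and p1: "p \<le> 1"
begin

lemma p0: "0 \<le> p"
  using n2 d4 by (simp add: p_def)

lemma p_times: "p * (real n - 1) = d"
  using n2 by (simp add: p_def)

lemma p_le: "p \<le> 2 * d / real n"
  using n2 d4 by (simp add: p_def field_simps)

lemma reach_card_bounds:
  assumes "E \<subseteq> all_edges n" "S \<subseteq> {1..n}"
  shows "card S \<le> card (reach E i S)" "card (reach E i S) \<le> n"
  using card_mono[OF finite_reach[OF assms] subset_reach, of i]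
    card_mono[OF _ reach_subset_V[OF assms], of i] by auto

text \<open>Going back one layer sends the exponent \<open>\<theta>\<close> to
  \<open>(exp \<theta> - 1) * d\<close>. The term \<open>(1 / d) ^ Suc i\<close> in the admissible
  range absorbs the quadratic error of each round. These errors form a geometric series, so the
  exponent reaching the first layer is at most 3/4 whatever the depth.\<close>

lemma layer_exp_moment:
  assumes v: "v \<in> {1..n}" and "0 \<le> \<theta>" "\<theta> \<le> (1 / 2 + (1 / d) ^ Suc i) * (1 / d) ^ i"
  shows "expect (all_edges n) p (\<lambda>E. exp \<theta> ^ card (layer E {v} (Suc i))) \<le> exp (2 * d)"
  using assms(2,3)
proof (induction i arbitrary: \<theta>)
  case (0 \<theta>)
  have st: "expect (all_edges n) p (\<lambda>E. 1 * exp \<theta> ^ card (layer E {v} (Suc 0)))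
      \<le> expect (all_edges n) p (\<lambda>E. 1 * exp ((exp \<theta> - 1) * d) ^ card (layer E {v} 0))"
  proof (rule expect_layer_step)
    fix E assume "E \<subseteq> all_edges n"
    have "(1 + (exp \<theta> - 1) * (1 - (1 - p) ^ card (layer E {v} 0))) ^ (n - card (reach E 0 {v}))
       \<le> exp ((exp \<theta> - 1) * (p * real (n - card (reach E 0 {v})))) ^ card (layer E {v} 0)"
      using p0 p1 0 by (intro nbr_factor_le_upper) auto
    also have "\<dots> \<le> exp ((exp \<theta> - 1) * d) ^ card (layer E {v} 0)"
      using p_times n2 by (simp add: of_nat_diff)
    finally show "(1 + (exp \<theta> - 1) * (1 - (1 - p) ^ card (layer E {v} 0))) ^ (n - card (reach E 0 {v}))
      \<le> exp ((exp \<theta> - 1) * d) ^ card (layer E {v} 0)" .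
  qed (use v p0 p1 in \<open>auto simp: adapted_def\<close>)
  have l: "card (layer E {v} 0) = 1" for E by (simp add: layer_def inner_def)
  have "1 / d \<le> 1 / 4" using d4 by (intro divide_left_mono) auto
  then have t: "\<theta> \<le> 3 / 4" using 0 by simp
  have "\<theta>\<^sup>2 \<le> 1 * \<theta>" unfolding power2_eq_square using t 0 by (intro mult_right_mono) auto
  moreover have "exp \<theta> \<le> 1 + \<theta> + \<theta>\<^sup>2" using 0 t by (intro exp_bound) auto
  ultimately have "exp \<theta> - 1 \<le> 2" using t by linarith
  then have "(exp \<theta> - 1) * d \<le> 2 * d" using d4 by (intro mult_right_mono) auto
  then have "exp ((exp \<theta> - 1) * d) \<le> exp (2 * d)" by simp
  moreover have "expect (all_edges n) p (\<lambda>E. exp \<theta> ^ card (layer E {v} (Suc 0)))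
      \<le> exp ((exp \<theta> - 1) * d)"
    using st by (simp add: l)
  ultimately show ?case by linarith
next
  case (Suc i \<theta>)
  define y where "y = (1 / d) ^ Suc i"
  have y: "0 < y" "y \<le> 1 / 4"
  proof -
    have "(1 / d) ^ Suc i \<le> (1 / d) ^ 1" using d4 by (intro power_decreasing) auto
    also have "\<dots> \<le> 1 / 4" using d4 by (simp add: field_simps)
    finally show "y \<le> 1 / 4" by (simp add: y_def)
  qed (use d4 in \<open>simp add: y_def\<close>)
  have dy: "d * y = (1 / d) ^ i" using d4 by (simp add: y_def)
  have th: "\<theta> \<le> (1 / 2 + y / d) * y" using Suc.prems(2) by (simp add: y_def)
  have half: "1 / 2 + y / d \<le> 1" using y d4 by (simp add: field_simps)
  have th_y: "\<theta> \<le> y"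
    using th mult_right_mono[OF half, of y] y by linarith
  define \<theta>' where "\<theta>' = (exp \<theta> - 1) * d"
  have "\<theta>' \<le> (\<theta> * (1 + \<theta>)) * d"
    unfolding \<theta>'_def using exp_bound[of \<theta>] th_y y Suc.prems d4
    by (intro mult_right_mono) (auto simp: power2_eq_square algebra_simps)
  also have "\<dots> \<le> (((1 / 2 + y / d) * y) * (1 + y)) * d"
    using th th_y y Suc.prems d4 by (intro mult_right_mono mult_mono) auto
  also have "\<dots> = (1 / 2 + y / d) * (1 + y) * (1 / d) ^ i"
    unfolding dy[symmetric] by (simp add: mult_ac)
  also have "\<dots> \<le> (1 / 2 + y) * (1 / d) ^ i"
  proof (rule mult_right_mono)
    have "y / d \<le> y / 4" using y d4 by (intro divide_left_mono) auto
    moreover have "(y / d) * y \<le> (y / 4) * 1" using y d4 by (intro mult_mono divide_left_mono) auto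
    moreover have "(1 / 2 + y / d) * (1 + y) = 1 / 2 + y / 2 + y / d + (y / d) * y"
      by (simp add: algebra_simps add_divide_distrib)
    ultimately show "(1 / 2 + y / d) * (1 + y) \<le> 1 / 2 + y" by linarith
  qed (use d4 in auto)
  finally have th': "\<theta>' \<le> (1 / 2 + (1 / d) ^ Suc i) * (1 / d) ^ i" by (simp add: y_def)
  have th'0: "0 \<le> \<theta>'" using Suc.prems d4 by (simp add: \<theta>'_def)
  have "expect (all_edges n) p (\<lambda>E. 1 * exp \<theta> ^ card (layer E {v} (Suc (Suc i))))
      \<le> expect (all_edges n) p (\<lambda>E. 1 * exp \<theta>' ^ card (layer E {v} (Suc i)))"
  proof (rule expect_layer_step)
    fix E assume E: "E \<subseteq> all_edges n"
    let ?R = "reach E (Suc i) {v}" and ?L = "layer E {v} (Suc i)"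
    have "1 \<le> card ?R" "card ?R \<le> n"
      using reach_card_bounds[OF E, of "{v}" "Suc i"] v by auto
    then have "p * real (n - card ?R) \<le> d"
      using mult_left_mono[OF _ p0, of "real (n - card ?R)" "real n - 1"] p_times
      by (simp add: of_nat_diff)
    then have "(exp \<theta> - 1) * (p * real (n - card ?R)) \<le> \<theta>'"
      unfolding \<theta>'_def using Suc.prems by (intro mult_left_mono) auto
    then have "exp ((exp \<theta> - 1) * (p * real (n - card ?R))) ^ card ?L \<le> exp \<theta>' ^ card ?L"
      by (rule exp_power_mono)
    moreover have "(1 + (exp \<theta> - 1) * (1 - (1 - p) ^ card ?L)) ^ (n - card ?R)
       \<le> exp ((exp \<theta> - 1) * (p * real (n - card ?R))) ^ card ?L"
      using p0 p1 Suc.prems by (intro nbr_factor_le_upper) auto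
    ultimately show "(1 + (exp \<theta> - 1) * (1 - (1 - p) ^ card ?L)) ^ (n - card ?R) \<le> exp \<theta>' ^ card ?L"
      by linarith
  qed (use v p0 p1 in \<open>auto simp: adapted_def\<close>)
  also have "\<dots> \<le> exp (2 * d)" using Suc.IH[OF th'0 th'] by simp
  finally show ?case by simp
qed

lemma layer_upper_tail:
  assumes v: "v \<in> {1..n}"
  shows "prb (all_edges n) p (\<lambda>E. K * d ^ Suc i \<le> real (card (layer E {v} (Suc i))))
       \<le> exp (2 * d - K * d / 2)"
proof -
  \<comment> \<open>Half of \<open>(1 / d) ^ i\<close> leaves room for the correction term; at the
    threshold the exponent is then \<open>K * d / 2\<close>.\<close>
  define \<theta> where "\<theta> = (1 / d) ^ i / 2"
  have th0: "0 \<le> \<theta>" using d4 by (simp add: \<theta>_def)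
  have "(1 / 2) * (1 / d) ^ i \<le> (1 / 2 + (1 / d) ^ Suc i) * (1 / d) ^ i"
    using d4 by (intro mult_right_mono) auto
  then have th: "\<theta> \<le> (1 / 2 + (1 / d) ^ Suc i) * (1 / d) ^ i" by (simp add: \<theta>_def)
  have thd: "\<theta> * d ^ Suc i = d / 2" using d4 by (simp add: \<theta>_def power_one_over)
  have "prb (all_edges n) p (\<lambda>E. K * d ^ Suc i \<le> real (card (layer E {v} (Suc i))))
     \<le> expect (all_edges n) p (\<lambda>E. exp \<theta> ^ card (layer E {v} (Suc i))) / exp (K * d / 2)"
  proof (rule prb_le_expect[OF p0 p1])
    fix E assume "K * d ^ Suc i \<le> real (card (layer E {v} (Suc i)))"
    then have "\<theta> * (K * d ^ Suc i) \<le> \<theta> * real (card (layer E {v} (Suc i)))"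
      using th0 by (rule mult_left_mono)
    moreover have "\<theta> * (K * d ^ Suc i) = K * (\<theta> * d ^ Suc i)" by (simp only: mult_ac)
    then have "\<theta> * (K * d ^ Suc i) = K * d / 2" unfolding thd by simp
    ultimately have "K * d / 2 \<le> real (card (layer E {v} (Suc i))) * \<theta>"
      by (simp only: mult.commute)
    then show "exp (K * d / 2) \<le> exp \<theta> ^ card (layer E {v} (Suc i))"
      unfolding exp_of_nat_mult[symmetric] by simp
  qed auto
  also have "\<dots> \<le> exp (2 * d) / exp (K * d / 2)"
    using layer_exp_moment[OF v th0 th] by (intro divide_right_mono) auto
  finally show ?thesis by (simp add: exp_diff)
qed

text \<open>\<open>\<rho>\<close> holds in advance the losses of all rounds: its
  \<open>d ^ i\<close> part pays for explored vertices and collisions, its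
  \<open>(1 / d) ^ i\<close> part for the quadratic term of the exponential. Both are geometric, so
  \<open>\<rho>\<close> stays between 1/2 and 1 on the layers considered. The recursion stops at
  layer 1, whose size is built into \<open>g\<close>: going back to \<open>S\<close> could gain only
  about \<open>exp (- d)\<close> per vertex, too little for a union bound.\<close>

lemma layer_lower_moment:
  assumes S: "S \<subseteq> {1..n}" and s: "s = real (card S)" and K1: "0 \<le> K1" and B: "0 \<le> B" "8 * B \<le> d"
    and small: "24 * K1 * s * d ^ j \<le> real n"
    and \<rho>: "\<And>i. \<rho> i = 1 - 6 * K1 * s / real n * (d ^ j - d ^ i) - 2 * B * (1 / d) ^ i"
    and g: "\<And>i E. g i E = of_bool (\<kappa> * d * s \<le> real (card (layer E S 1))
        \<and> (\<forall>k<i. real (card (reach E k S)) \<le> s * K1 * d ^ k))"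
    and "1 \<le> i" "i \<le> j"
  shows "expect (all_edges n) p (\<lambda>E. g i E * exp (- (B * d * (1 / d) ^ i * \<rho> i)) ^ card (layer E S i))
       \<le> exp (- (B * d * (1 / d) ^ 1 * \<rho> 1) * (\<kappa> * d * s))"
  using \<open>1 \<le> i\<close> \<open>i \<le> j\<close>
proof (induction i rule: dec_induct)
  have dpos: "0 < d" using d4 by simp
  have npos: "0 < real n" using n2 by simp
  define \<alpha> where "\<alpha> = 6 * K1 * s / real n"
  have \<alpha>0: "0 \<le> \<alpha>" using K1 s by (simp add: \<alpha>_def)
  have \<alpha>j: "\<alpha> * d ^ j \<le> 1 / 4" using small npos by (simp add: \<alpha>_def field_simps)
  have \<rho>': "\<rho> i = 1 - \<alpha> * (d ^ j - d ^ i) - 2 * B * (1 / d) ^ i" for i by (simp add: \<rho> \<alpha>_def)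
  have \<rho>_le: "\<rho> i \<le> 1" if "i \<le> j" for i
  proof -
    have "d ^ i \<le> d ^ j" using that d4 by (intro power_increasing) auto
    then have "0 \<le> \<alpha> * (d ^ j - d ^ i)" using \<alpha>0 by (intro mult_nonneg_nonneg) linarith+
    moreover have "0 \<le> 2 * B * (1 / d) ^ i" using B dpos by simp
    ultimately show ?thesis unfolding \<rho>' by linarith
  qed
  have \<rho>_ge: "1 / 2 \<le> \<rho> i" if "1 \<le> i" for i
  proof -
    have "\<alpha> * (d ^ j - d ^ i) \<le> \<alpha> * d ^ j" using \<alpha>0 dpos by (intro mult_left_mono) auto
    moreover have "(1 / d) ^ i \<le> (1 / d) ^ 1" using that d4 by (intro power_decreasing) auto
    then have "2 * B * (1 / d) ^ i \<le> 2 * B * (1 / d)" using B by (intro mult_left_mono) auto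
    moreover have "2 * B * (1 / d) \<le> 1 / 4" using B dpos by (simp add: field_simps)
    ultimately show ?thesis unfolding \<rho>' using \<alpha>j by linarith
  qed
  {
    case base
    have th: "0 \<le> B * d * (1 / d) ^ 1 * \<rho> 1" using B \<rho>_ge[of 1] dpos by (intro mult_nonneg_nonneg) auto
    have "expect (all_edges n) p (\<lambda>E. g 1 E * exp (- (B * d * (1 / d) ^ 1 * \<rho> 1)) ^ card (layer E S 1))
      \<le> expect (all_edges n) p (\<lambda>E. exp (- (B * d * (1 / d) ^ 1 * \<rho> 1) * (\<kappa> * d * s)))"
    proof (rule expect_mono[OF p0 p1])
      fix E
      show "g 1 E * exp (- (B * d * (1 / d) ^ 1 * \<rho> 1)) ^ card (layer E S 1)
          \<le> exp (- (B * d * (1 / d) ^ 1 * \<rho> 1) * (\<kappa> * d * s))"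
      proof (cases "\<kappa> * d * s \<le> real (card (layer E S 1))")
        case True
        have "exp (- (B * d * (1 / d) ^ 1 * \<rho> 1)) ^ card (layer E S 1)
          = exp (- (B * d * (1 / d) ^ 1 * \<rho> 1) * real (card (layer E S 1)))"
          unfolding exp_of_nat_mult[symmetric] by (simp add: mult_ac)
        also have "\<dots> \<le> exp (- (B * d * (1 / d) ^ 1 * \<rho> 1) * (\<kappa> * d * s))"
          using mult_left_mono[OF True th] by simp
        finally show ?thesis by (auto simp: g)
      qed (simp add: g)
    qed
    then show ?case by simp
  next
    case (step i)
    then have i: "1 \<le> i" "i < j" by auto
    define \<theta> where "\<theta> = B * d * (1 / d) ^ Suc i * \<rho> (Suc i)"
    define y where "y = B * (1 / d) ^ i"
    \<comment> \<open>Equal to \<open>3 * d * t / n\<close> at the largest ball size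
      \<open>t = s * K1 * d ^ i\<close> that the truncation allows.\<close>
    define \<eta> where "\<eta> = \<alpha> * d ^ Suc i / 2"
    have th: "\<theta> = y * \<rho> (Suc i)" using dpos by (simp add: \<theta>_def y_def)
    have y0: "0 \<le> y" using B dpos by (simp add: y_def)
    have y4: "y \<le> 1 / 4"
    proof -
      have "(1 / d) ^ i \<le> (1 / d) ^ 1" using i d4 by (intro power_decreasing) auto
      then have "y \<le> B * (1 / d)" unfolding y_def using B by (intro mult_left_mono) auto
      also have "\<dots> \<le> 1 / 4" using B dpos by (simp add: field_simps)
      finally show ?thesis .
    qed
    have eta0: "0 \<le> \<eta>" using \<alpha>0 dpos by (simp add: \<eta>_def)
    have eta4: "\<eta> \<le> 1 / 4"
    proof -
      have "d ^ Suc i \<le> d ^ j" using i d4 by (intro power_increasing) auto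
      then have "\<alpha> * d ^ Suc i \<le> \<alpha> * d ^ j" using \<alpha>0 by (intro mult_left_mono) auto
      then show ?thesis using \<alpha>j \<alpha>0 dpos eta0 by (simp add: \<eta>_def)
    qed
    have r: "1 / 2 \<le> \<rho> (Suc i)" "\<rho> (Suc i) \<le> 1" using \<rho>_ge[of "Suc i"] \<rho>_le[of "Suc i"] i by auto
    have th0: "0 \<le> \<theta>" using th y0 r by simp
    have th_y: "\<theta> \<le> y" unfolding th using y0 r mult_left_mono[of "\<rho> (Suc i)" 1 y] by simp
    \<comment> \<open>Consecutive powers differ by at least half of the larger one, so one increment
      of \<open>\<rho>\<close> covers both losses of the round.\<close>
    have rho_step: "\<rho> i \<le> \<rho> (Suc i) - (\<eta> + y)"
    proof -
      have "d ^ Suc i / 2 \<le> d ^ Suc i - d ^ i"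
      proof -
        have "2 * d ^ i \<le> d * d ^ i" using d4 by (intro mult_right_mono) auto
        then show ?thesis by simp
      qed
      then have "\<eta> \<le> \<alpha> * (d ^ Suc i - d ^ i)"
        unfolding \<eta>_def using mult_left_mono[OF _ \<alpha>0, of "d ^ Suc i / 2" "d ^ Suc i - d ^ i"] by simp
      moreover have "y \<le> 2 * B * ((1 / d) ^ i - (1 / d) ^ Suc i)"
      proof -
        have "(1 / d) * (1 / d) ^ i \<le> (1 / 2) * (1 / d) ^ i" using d4
          by (intro mult_right_mono) auto
        then have "(1 / d) ^ i / 2 \<le> (1 / d) ^ i - (1 / d) ^ Suc i" by simp
        then have "2 * B * ((1 / d) ^ i / 2) \<le> 2 * B * ((1 / d) ^ i - (1 / d) ^ Suc i)"
          using B by (intro mult_left_mono) auto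
        then show ?thesis by (simp add: y_def)
      qed
      ultimately show ?thesis unfolding \<rho>' by (simp only: right_diff_distrib)
    qed
    have key: "B * d * (1 / d) ^ i * \<rho> i \<le> (1 - \<eta>) * (d * (\<theta> * (1 - \<theta>)))"
    proof -
      have "\<rho> (Suc i) * (1 - \<eta> - y) \<ge> \<rho> (Suc i) - (\<eta> + y)"
        using mult_right_mono[OF r(2), of "\<eta> + y"] eta0 y0 by (simp add: algebra_simps)
      moreover have "1 - \<eta> - y \<le> (1 - \<eta>) * (1 - y)" using eta0 y0 by (simp add: algebra_simps)
      moreover have "(1 - \<eta>) * (1 - y) \<le> (1 - \<eta>) * (1 - \<theta>)"
        using th_y eta4 by (intro mult_left_mono) auto
      ultimately have "\<rho> i \<le> \<rho> (Suc i) * ((1 - \<eta>) * (1 - \<theta>))"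
        using rho_step mult_left_mono[of "1 - \<eta> - y" "(1 - \<eta>) * (1 - \<theta>)" "\<rho> (Suc i)"] r by linarith
      then have "(d * y) * \<rho> i \<le> (d * y) * (\<rho> (Suc i) * ((1 - \<eta>) * (1 - \<theta>)))"
        using dpos y0 by (intro mult_left_mono) auto
      then show ?thesis unfolding th y_def by (simp add: mult_ac)
    qed
    let ?u = "exp (- (B * d * (1 / d) ^ i * \<rho> i))"
    have "expect (all_edges n) p (\<lambda>E. g (Suc i) E * exp (- \<theta>) ^ card (layer E S (Suc i)))
      \<le> expect (all_edges n) p (\<lambda>E. g (Suc i) E * ?u ^ card (layer E S i))"
    proof (rule expect_layer_step[OF S p0 p1])
      \<comment> \<open>\<open>g (Suc i)\<close> inspects balls of radius at most \<open>i\<close>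
        and the first layer; as \<open>i \<ge> 1\<close>, both are known after \<open>i\<close>
        rounds.\<close>
      show "adapted n S i (g (Suc i))"
        unfolding adapted_def
      proof (intro allI impI)
        fix E E' assume E: "E \<subseteq> all_edges n" "E' \<subseteq> all_edges n"
          "E \<inter> meeting n (inner E S i) = E' \<inter> meeting n (inner E S i)"
        have R: "reach E' k S = reach E k S" if "k \<le> i" for k using reach_local[OF E that] .
        have "layer E' S 1 = layer E S 1"
          using R[of 1] R[of 0] i by (simp add: layer_def inner_def)
        then show "g (Suc i) E = g (Suc i) E'" unfolding g using R by (auto simp: less_Suc_eq_le)
      qed
      show "0 \<le> g (Suc i) E" for E by (simp add: g)
      fix E assume E: "E \<subseteq> all_edges n" "g (Suc i) E \<noteq> 0"
      define t where "t = real (card (reach E i S))"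
      define a where "a = real (card (layer E S i))"
      have t_le: "t \<le> s * K1 * d ^ i" using E(2) by (auto simp: g t_def split: if_splits)
      have t0: "0 \<le> t" by (simp add: t_def)
      have a_le: "a \<le> t" unfolding a_def t_def using finite_reach[OF E(1) S]
        by (simp add: card_mono layer_def)
      have tn: "card (reach E i S) \<le> n" using reach_card_bounds[OF E(1) S] by simp
      have dt: "3 * d * t / real n \<le> \<eta>"
      proof -
        have "3 * d * t / real n \<le> 3 * d * (s * K1 * d ^ i) / real n"
          using t_le dpos npos by (intro divide_right_mono mult_left_mono) auto
        also have "\<dots> = \<eta>" by (simp add: \<eta>_def \<alpha>_def)
        finally show ?thesis .
      qed
      \<comment> \<open>Explored vertices cost the factor \<open>1 - t / n\<close>, collisions cost
        \<open>1 - 2 * d * t / n\<close>; together at most \<open>3 * d * t / n\<close> is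
        lost.\<close>
      have f1: "d * (1 - t / real n) \<le> p * real (n - card (reach E i S))"
      proof -
        have "d * (1 - t / real n) = (d / real n) * (real n - t)" using npos by (simp add: field_simps)
        also have "\<dots> \<le> p * (real n - t)"
        proof (rule mult_right_mono)
          show "d / real n \<le> p" unfolding p_def using n2 dpos by (intro divide_left_mono) auto
        qed (use tn in \<open>simp add: t_def\<close>)
        finally show ?thesis using tn by (simp add: t_def of_nat_diff)
      qed
      have f2: "1 - 2 * d * t / real n \<le> 1 - p * a"
      proof -
        have "p * a \<le> (2 * d / real n) * t" using p_le a_le p0 t0 dpos
          by (intro mult_mono) (auto simp: a_def)
        then show ?thesis by simp
      qed
      have f3: "1 - 3 * d * t / real n \<le> (1 - t / real n) * (1 - 2 * d * t / real n)"
      proof -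
        have "t / real n \<le> d * t / real n"
          using d4 t0 npos by (intro divide_right_mono) (simp add: mult_le_cancel_right1)+
        moreover have "0 \<le> (t / real n) * (2 * d * t / real n)" using t0 dpos by simp
        moreover have "(1 - x) * (1 - y) = 1 - x - y + x * y" for x y :: real
          by (simp add: algebra_simps)
        moreover have "3 * d * t / real n = 3 * (d * t / real n)" "2 * d * t / real n = 2 * (d * t / real n)"
          by simp_all
        ultimately show ?thesis by simp
      qed
      have tn1: "t / real n \<le> 1" "2 * d * t / real n \<le> 1"
      proof -
        have "3 * d * t / real n = 3 * (d * t / real n)" "2 * d * t / real n = 2 * (d * t / real n)"
          by simp_all
        note this dt eta4
        moreover have "t / real n \<le> d * t / real n"
          using d4 t0 npos by (intro divide_right_mono) (simp add: mult_le_cancel_right1)+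
        moreover have "0 \<le> d * t / real n" using t0 dpos by simp
        ultimately show "t / real n \<le> 1" "2 * d * t / real n \<le> 1" by linarith+
      qed
      have "1 - \<eta> \<le> (1 - t / real n) * (1 - 2 * d * t / real n)" using f3 dt by linarith
      from mult_right_mono[OF this, of d]
      have "(1 - \<eta>) * d \<le> (d * (1 - t / real n)) * (1 - 2 * d * t / real n)"
        using dpos by (simp add: mult_ac)
      also have "\<dots> \<le> (p * real (n - card (reach E i S))) * (1 - p * a)"
        by (rule mult_mono[OF f1 f2]) (use tn1 dpos p0 in auto)
      finally have F: "(1 - \<eta>) * d \<le> p * real (n - card (reach E i S)) * (1 - p * a)" .
      have z: "\<theta> * (1 - \<theta>) \<le> 1 - exp (- \<theta>)"
        using exp_minus_le_quadratic[OF th0] by (simp add: algebra_simps power2_eq_square)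
      have "B * d * (1 / d) ^ i * \<rho> i \<le> (\<theta> * (1 - \<theta>)) * ((1 - \<eta>) * d)"
        using key by (simp add: mult_ac)
      also have "\<dots> \<le> (1 - exp (- \<theta>)) * (p * real (n - card (reach E i S)) * (1 - p * a))"
        by (rule mult_mono[OF z F]) (use th0 eta4 dpos in auto)
      finally have le: "- ((1 - exp (- \<theta>)) * (p * real (n - card (reach E i S)) * (1 - p * a)))
          \<le> - (B * d * (1 / d) ^ i * \<rho> i)" by simp
      have "(1 + (exp (- \<theta>) - 1) * (1 - (1 - p) ^ card (layer E S i))) ^ (n - card (reach E i S))
        \<le> exp (- ((1 - exp (- \<theta>)) * (p * real (n - card (reach E i S)) * (1 - p * a))))
            ^ card (layer E S i)"
        unfolding a_def using p0 p1 th0 by (intro nbr_factor_le_lower) auto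
      also have "\<dots> \<le> ?u ^ card (layer E S i)" using le by (rule exp_power_mono)
      finally show "(1 + (exp (- \<theta>) - 1) * (1 - (1 - p) ^ card (layer E S i))) ^ (n - card (reach E i S))
        \<le> ?u ^ card (layer E S i)" .
    qed
    \<comment> \<open>Forgetting the truncation at radius \<open>i\<close> turns
      \<open>g (Suc i)\<close> back into \<open>g i\<close>.\<close>
    also have "\<dots> \<le> expect (all_edges n) p (\<lambda>E. g i E * ?u ^ card (layer E S i))"
      by (intro expect_mono p0 p1 mult_right_mono) (auto simp: g)
    also have "\<dots> \<le> exp (- (B * d * (1 / d) ^ 1 * \<rho> 1) * (\<kappa> * d * s))"
      using step.IH i by simp
    finally show ?case unfolding \<theta>_def .
  }
qed

text \<open>The \<open>\<kappa> * d * s\<close> vertices of the first layer contribute at least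
  \<open>B / 2\<close> each to the exponent; the threshold on layer \<open>j\<close> costs at most
  half of the total, and the other half is the bound.\<close>

lemma layer_lower_tail:
  assumes S: "S \<subseteq> {1..n}" and s: "s = real (card S)" and K1: "0 \<le> K1" and B: "0 \<le> B" "8 * B \<le> d"
    and small: "24 * K1 * s * d ^ j \<le> real n" and j: "1 \<le> j" and \<kappa>: "0 \<le> \<kappa>"
  shows "prb (all_edges n) p (\<lambda>E. \<kappa> * d * s \<le> real (card (layer E S 1))
        \<and> (\<forall>k<j. real (card (reach E k S)) \<le> s * K1 * d ^ k)
        \<and> real (card (layer E S j)) \<le> \<kappa> / 4 * s * d ^ j) \<le> exp (- (B * \<kappa> * s * d / 4))"
proof -
  have dpos: "0 < d" using d4 by simp
  have npos: "0 < real n" using n2 by simp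
  define \<rho> where "\<rho> i = 1 - 6 * K1 * s / real n * (d ^ j - d ^ i) - 2 * B * (1 / d) ^ i" for i
  define g :: "nat \<Rightarrow> nat set set \<Rightarrow> real" where "g i E = of_bool (\<kappa> * d * s \<le> real (card (layer E S 1))
        \<and> (\<forall>k<i. real (card (reach E k S)) \<le> s * K1 * d ^ k))" for i E
  define \<theta> where "\<theta> = B * d * (1 / d) ^ j * \<rho> j"
  have \<rho>j: "\<rho> j \<le> 1" using B dpos by (simp add: \<rho>_def)
  have \<rho>1: "1 / 2 \<le> \<rho> 1"
  proof -
    have "6 * K1 * s / real n * (d ^ j - d ^ 1) \<le> 6 * K1 * s / real n * d ^ j"
      using K1 s dpos by (intro mult_left_mono) auto
    also have "\<dots> \<le> 1 / 4" using small npos by (simp add: field_simps)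
    finally have "6 * K1 * s / real n * (d ^ j - d ^ 1) \<le> 1 / 4" .
    moreover have "2 * B * (1 / d) \<le> 1 / 4" using B dpos by (simp add: field_simps)
    ultimately show ?thesis by (simp add: \<rho>_def)
  qed
  have \<rho>j0: "0 \<le> \<rho> j"
  proof -
    have "(1 / d) ^ j \<le> (1 / d) ^ 1" using j d4 by (intro power_decreasing) auto
    then have "2 * B * (1 / d) ^ j \<le> 2 * B * (1 / d)" using B by (intro mult_left_mono) auto
    moreover have "2 * B * (1 / d) \<le> 1 / 4" using B dpos by (simp add: field_simps)
    ultimately show ?thesis by (simp add: \<rho>_def)
  qed
  have th0: "0 \<le> \<theta>" using B dpos \<rho>j0 by (simp add: \<theta>_def)
  have thd: "\<theta> * (\<kappa> / 4 * s * d ^ j) \<le> B * \<kappa> * s * d / 4"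
  proof -
    have "\<theta> * (\<kappa> / 4 * s * d ^ j) = (B * \<kappa> * s * d / 4) * \<rho> j"
      using dpos by (simp add: \<theta>_def power_one_over)
    also have "\<dots> \<le> (B * \<kappa> * s * d / 4) * 1"
      using \<rho>j B \<kappa> s dpos by (intro mult_left_mono) auto
    finally show ?thesis by simp
  qed
  have "prb (all_edges n) p (\<lambda>E. \<kappa> * d * s \<le> real (card (layer E S 1))
        \<and> (\<forall>k<j. real (card (reach E k S)) \<le> s * K1 * d ^ k)
        \<and> real (card (layer E S j)) \<le> \<kappa> / 4 * s * d ^ j)
    \<le> expect (all_edges n) p (\<lambda>E. g j E * exp (- \<theta>) ^ card (layer E S j)) / exp (- (B * \<kappa> * s * d / 4))"
  proof (rule prb_le_expect[OF p0 p1])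
    fix E assume a: "\<kappa> * d * s \<le> real (card (layer E S 1))
        \<and> (\<forall>k<j. real (card (reach E k S)) \<le> s * K1 * d ^ k)
        \<and> real (card (layer E S j)) \<le> \<kappa> / 4 * s * d ^ j"
    then have "\<theta> * real (card (layer E S j)) \<le> \<theta> * (\<kappa> / 4 * s * d ^ j)"
      using th0 by (intro mult_left_mono) auto
    then have "exp (- (B * \<kappa> * s * d / 4)) \<le> exp (real (card (layer E S j)) * (- \<theta>))"
      using thd by (simp add: mult_ac)
    moreover have "g j E = 1" using a by (simp add: g_def)
    ultimately show "exp (- (B * \<kappa> * s * d / 4)) \<le> g j E * exp (- \<theta>) ^ card (layer E S j)"
      unfolding exp_of_nat_mult by simp
  qed (auto simp: g_def)
  also have "\<dots> \<le> exp (- (B * d * (1 / d) ^ 1 * \<rho> 1) * (\<kappa> * d * s)) / exp (- (B * \<kappa> * s * d / 4))"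
    unfolding \<theta>_def
    by (intro divide_right_mono layer_lower_moment[OF S s K1 B small \<rho>_def g_def j]) auto
  also have "\<dots> = exp (B * \<kappa> * s * d / 4 - B * \<rho> 1 * (\<kappa> * d * s))"
    using dpos by (simp add: exp_diff[symmetric] mult_ac)
  also have "\<dots> \<le> exp (- (B * \<kappa> * s * d / 4))"
  proof -
    have "(B * \<kappa> * s * d) * (1 / 2) \<le> (B * \<kappa> * s * d) * \<rho> 1"
      using \<rho>1 B \<kappa> s dpos by (intro mult_left_mono) auto
    then show ?thesis by (simp add: mult_ac)
  qed
  finally show ?thesis .
qed

end

section \<open>Sparsity, degrees and random cop positions\<close>

lemma sum_subsets_by_card:
  fixes t :: "nat \<Rightarrow> real"
  assumes fin: "finite V" and I: "I \<subseteq> Pow V" and J: "finite J" "card ` I \<subseteq> J" and t: "\<And>w. 0 \<le> t w"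
  shows "(\<Sum>W\<in>I. t (card W)) \<le> (\<Sum>w\<in>J. real (card V choose w) * t w)"
proof -
  have finI: "finite I" using I fin by (meson finite_Pow_iff finite_subset)
  have "(\<Sum>W\<in>I. t (card W)) = (\<Sum>w\<in>J. \<Sum>W | W \<in> I \<and> card W = w. t (card W))"
    by (rule sum.group[OF finI J, symmetric])
  also have "\<dots> \<le> (\<Sum>w\<in>J. real (card V choose w) * t w)"
  proof (rule sum_mono)
    fix w assume "w \<in> J"
    have "(\<Sum>W | W \<in> I \<and> card W = w. t (card W)) = real (card {W. W \<in> I \<and> card W = w}) * t w"
      by simp
    also have "card {W. W \<in> I \<and> card W = w} \<le> card {W. W \<subseteq> V \<and> card W = w}"
      using I fin by (intro card_mono) auto
    also have "\<dots> = card V choose w" by (rule n_subsets[OF fin])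
    finally show "(\<Sum>W | W \<in> I \<and> card W = w. t (card W)) \<le> real (card V choose w) * t w"
      using t[of w] by (simp add: mult_right_mono)
  qed
  finally show ?thesis .
qed

text \<open>One term of the exponential series at \<open>w\<close>.\<close>

lemma power_self_le_fact_exp: "real w ^ w \<le> fact w * exp (real w)"
proof -
  have "(\<Sum>k\<in>{w}. real w ^ k /\<^sub>R fact k) \<le> (\<Sum>k. real w ^ k /\<^sub>R fact k)"
    by (rule sum_le_suminf[OF summable_exp_generic]) auto
  then have "real w ^ w / fact w \<le> exp (real w)" by (simp add: exp_def divide_inverse mult_ac)
  then show ?thesis by (simp add: field_simps)
qed

text \<open>The usual \<open>(n choose w) \<le> (e n / w) ^ w\<close>, free of division.\<close>

lemma binomial_mult_power_self_le: "real (n choose w) * real w ^ w \<le> (real n * exp 1) ^ w"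
proof -
  have e: "exp (real w) = exp 1 ^ w" by (simp add: exp_of_nat_mult[symmetric])
  have "(n choose w) * fact w \<le> n ^ w"
    by (cases "w \<le> n") (auto simp: binomial_fact_pow binomial_eq_0)
  then have b: "real (n choose w) * fact w \<le> real n ^ w"
    by (metis of_nat_fact of_nat_le_iff of_nat_mult of_nat_power)
  have "real (n choose w) * real w ^ w \<le> real (n choose w) * (fact w * exp (real w))"
    by (intro mult_left_mono power_self_le_fact_exp) simp
  also have "\<dots> \<le> real n ^ w * exp (real w)"
    using mult_right_mono[OF b, of "exp (real w)"] by (simp add: mult_ac)
  also have "\<dots> = (real n * exp 1) ^ w" by (simp add: e power_mult_distrib)
  finally show ?thesis .
qed

lemma binomial_le_power_real: "real (n choose w) \<le> real n ^ w"
proof (cases "w \<le> n")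
  case True
  then show ?thesis using binomial_le_pow[OF True] by (metis of_nat_le_iff of_nat_power)
next
  case False
  then show ?thesis by (simp add: binomial_eq_0)
qed

lemma sum_power_le_twice:
  fixes x :: real
  assumes "0 \<le> x" "x \<le> 1 / 2"
  shows "(\<Sum>w\<in>{1..n}. x ^ w) \<le> 2 * x"
proof -
  \<comment> \<open>Subtracting the last power strengthens the claim enough for induction.\<close>
  have "(\<Sum>w\<in>{1..n}. x ^ w) \<le> 2 * x - x ^ n" if "1 \<le> n"
    using that
  proof (induction n rule: dec_induct)
    case (step m)
    have "x ^ m * (2 * x) \<le> x ^ m * 1" using assms by (intro mult_left_mono) auto
    then show ?case using step.IH by (simp add: mult_ac)
  qed simp
  moreover have "0 \<le> x ^ n" using assms by simp
  ultimately have "1 \<le> n \<Longrightarrow> ?thesis" by linarith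
  then show ?thesis using assms by (cases "1 \<le> n") auto
qed

section \<open>Small vertex sets span few edges\<close>

text \<open>Exponential moment with \<open>z = n / (w d)\<close>, which is close to
  \<open>1 / (p w)\<close>: the at most \<open>w^2\<close> possible edges contribute
  \<open>exp (2 w)\<close> at most, and each of the \<open>4 w\<close> edges costs a factor
  \<open>1 / z\<close>.\<close>

lemma (in sparse_gnp) dense_set_prob:
  assumes W: "W \<subseteq> {1..n}" and w: "w = card W" "1 \<le> w" and small: "real w * d\<^sup>2 \<le> real n"
  shows "prb (all_edges n) p (\<lambda>E. 4 * w \<le> card (E \<inter> Pow W))
       \<le> exp (2 * real w) * (real w * d / real n) ^ (4 * w)"
proof -
  have npos: "0 < real n" and dpos: "0 < d" and wpos: "0 < real w" using n2 d4 w by auto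
  define F where "F = all_edges n \<inter> Pow W"
  define z where "z = real n / (real w * d)"
  have finW: "finite W" using W by (rule finite_subset) simp
  have "F \<subseteq> (\<lambda>(a, b). {a, b}) ` (W \<times> W)" unfolding F_def all_edges_def by auto
  then have "card F \<le> card ((\<lambda>(a, b). {a, b}) ` (W \<times> W))" using finW by (intro card_mono) auto
  also have "\<dots> \<le> card (W \<times> W)" using finW by (intro card_image_le) auto
  finally have cF: "card F \<le> w * w" by (simp add: card_cartesian_product w)
  have "real w * d * 1 \<le> real w * d * d" using d4 wpos by (intro mult_left_mono) auto
  then have "real w * d \<le> real n" using small by (simp add: power2_eq_square mult.assoc[symmetric])
  then have z1: "1 \<le> z" using wpos dpos unfolding z_def by simp
  have zp: "z * p * (real w * real w) \<le> 2 * real w"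
  proof -
    have "z * p * (real w * real w) = real w * (real n / (real n - 1))"
      using wpos dpos n2 by (simp add: z_def p_def field_simps)
    also have "\<dots> \<le> real w * 2" using n2 by (intro mult_left_mono) (auto simp: field_simps)
    finally show ?thesis by simp
  qed
  have "prb (all_edges n) p (\<lambda>E. 4 * w \<le> card (E \<inter> Pow W))
      \<le> expect (all_edges n) p (\<lambda>E. z ^ card (E \<inter> F)) / z ^ (4 * w)"
  proof (rule prb_le_expect[OF p0 p1])
    fix E assume E: "E \<subseteq> all_edges n" "4 * w \<le> card (E \<inter> Pow W)"
    have "E \<inter> Pow W = E \<inter> F" using E by (auto simp: F_def)
    then show "z ^ (4 * w) \<le> z ^ card (E \<inter> F)" using E z1 by (intro power_increasing) auto
  qed (use z1 in auto)
  also have "expect (all_edges n) p (\<lambda>E. z ^ card (E \<inter> F)) = (1 + (z - 1) * p) ^ card F"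
    by (rule expect_power_card) (auto simp: F_def)
  also have "\<dots> \<le> exp (2 * real w)"
  proof -
    have zp0: "0 \<le> (z - 1) * p" using z1 p0 by simp
    have "(1 + (z - 1) * p) ^ card F \<le> exp ((z - 1) * p) ^ card F"
      using zp0 by (intro power_mono) auto
    also have "\<dots> \<le> exp ((z - 1) * p) ^ (w * w)"
      using zp0 cF by (intro power_increasing) auto
    also have "\<dots> = exp ((z - 1) * p * (real w * real w))"
      unfolding exp_of_nat_mult[symmetric] by (simp add: mult_ac)
    also have "(z - 1) * p * (real w * real w) \<le> z * p * (real w * real w)"
      using p0 by (intro mult_right_mono) auto
    finally show ?thesis using zp by (meson exp_le_cancel_iff order_trans)
  qed
  finally have "prb (all_edges n) p (\<lambda>E. 4 * w \<le> card (E \<inter> Pow W)) \<le> exp (2 * real w) / z ^ (4 * w)"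
    using z1 by (simp add: divide_right_mono)
  also have "\<dots> = exp (2 * real w) * (real w * d / real n) ^ (4 * w)"
    by (simp add: z_def power_divide)
  finally show ?thesis .
qed

definition locally_sparse :: "nat \<Rightarrow> real \<Rightarrow> nat set set \<Rightarrow> bool" where
  "locally_sparse n d E \<longleftrightarrow> (\<forall>W \<subseteq> {1..n}. W \<noteq> {} \<longrightarrow> real (card W) * d\<^sup>2 \<le> real n \<longrightarrow>
     card (E \<inter> Pow W) < 4 * card W)"

text \<open>With \<open>y = w / n \<le> 1 / d^2\<close>, the binomial coefficient takes back one
  factor \<open>y\<close> of \<open>(y d) ^ 4\<close> and leaves
  \<open>y^3 d^4 \<le> 1 / d^2\<close>. Four edges per vertex thus give a geometric series whose
  ratio tends to 0 as \<open>d\<close> grows.\<close>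

lemma (in sparse_gnp) not_locally_sparse_prob:
  assumes d_large: "2 * exp 3 \<le> d\<^sup>2"
  shows "prb (all_edges n) p (\<lambda>E. \<not> locally_sparse n d E) \<le> 2 * exp 3 / d\<^sup>2"
proof -
  have npos: "0 < real n" and dpos: "0 < d" using n2 d4 by auto
  define I where "I = {W \<in> Pow {1..n}. W \<noteq> {} \<and> real (card W) * d\<^sup>2 \<le> real n}"
  define J where "J = {w \<in> {1..n}. real w * d\<^sup>2 \<le> real n}"
  define t where "t w = exp (2 * real w) * (real w * d / real n) ^ (4 * w)" for w
  define x where "x = exp 3 / d\<^sup>2"
  have finI: "finite I" by (simp add: I_def)
  have wpos: "1 \<le> card W" if "W \<in> I" for W
    using that finite_subset[of W "{1..n}"] by (auto simp: I_def Suc_le_eq card_gt_0_iff)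
  have "prb (all_edges n) p (\<lambda>E. \<not> locally_sparse n d E)
      \<le> prb (all_edges n) p (\<lambda>E. \<exists>W\<in>I. 4 * card W \<le> card (E \<inter> Pow W))"
    by (rule prb_mono[OF p0 p1]) (auto simp: locally_sparse_def I_def not_less)
  also have "\<dots> \<le> (\<Sum>W\<in>I. prb (all_edges n) p (\<lambda>E. 4 * card W \<le> card (E \<inter> Pow W)))"
    by (rule prb_Bex_le[OF p0 p1 finI])
  also have "\<dots> \<le> (\<Sum>W\<in>I. t (card W))"
    unfolding t_def using wpos by (intro sum_mono dense_set_prob) (auto simp: I_def)
  also have "\<dots> \<le> (\<Sum>w\<in>J. real (card {1..n} choose w) * t w)"
  proof (rule sum_subsets_by_card)
    show "card ` I \<subseteq> J"
      using wpos card_mono[of "{1..n}"] by (auto simp: I_def J_def)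
    show "0 \<le> t w" for w using npos dpos by (simp add: t_def)
  qed (auto simp: I_def J_def)
  also have "\<dots> \<le> (\<Sum>w\<in>J. x ^ w)"
  proof (rule sum_mono)
    fix w assume w: "w \<in> J"
    define y where "y = real w / real n"
    have y0: "0 < y" using w npos by (simp add: y_def J_def)
    have yd: "y \<le> 1 / d\<^sup>2" using w npos dpos by (simp add: y_def J_def field_simps)
    have "real (card {1..n} choose w) * t w
        = (real (n choose w) * real w ^ w) * (exp 2 ^ w * (real w ^ 3 * d ^ 4 / real n ^ 4) ^ w)"
    proof -
      have "(real w * d / real n) ^ (4 * w) = ((real w * d / real n) ^ 4) ^ w" by (simp add: power_mult)
      also have "(real w * d / real n) ^ 4 = real w * (real w ^ 3 * d ^ 4 / real n ^ 4)"
        by (simp add: power_divide power_mult_distrib power_Suc[symmetric])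
      also have "(real w * (real w ^ 3 * d ^ 4 / real n ^ 4)) ^ w
          = real w ^ w * (real w ^ 3 * d ^ 4 / real n ^ 4) ^ w"
        by (rule power_mult_distrib)
      finally have "(real w * d / real n) ^ (4 * w) = real w ^ w * (real w ^ 3 * d ^ 4 / real n ^ 4) ^ w" .
      moreover have "exp (2 * real w) = exp 2 ^ w" by (simp add: exp_of_nat_mult[symmetric] mult.commute)
      ultimately show ?thesis by (simp add: t_def mult_ac)
    qed
    also have "\<dots> \<le> (real n * exp 1) ^ w * (exp 2 ^ w * (real w ^ 3 * d ^ 4 / real n ^ 4) ^ w)"
      using dpos by (intro mult_right_mono binomial_mult_power_self_le) auto
    also have "\<dots> = (real n * exp 1 * (exp 2 * (real w ^ 3 * d ^ 4 / real n ^ 4))) ^ w"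
      by (simp only: power_mult_distrib)
    also have "real n * exp 1 * (exp 2 * (real w ^ 3 * d ^ 4 / real n ^ 4)) = exp 3 * (y ^ 3 * d ^ 4)"
    proof -
      have e3: "exp 3 = exp 1 * exp (2::real)" by (simp add: exp_add[symmetric])
      have q: "real n * (real w ^ 3 * d ^ 4 / real n ^ 4) = y ^ 3 * d ^ 4"
        using npos by (simp add: y_def power_divide power3_eq_cube power4_eq_xxxx)
      have "real n * exp 1 * (exp 2 * (real w ^ 3 * d ^ 4 / real n ^ 4))
          = (exp 1 * exp 2) * (real n * (real w ^ 3 * d ^ 4 / real n ^ 4))"
        by (simp only: mult_ac)
      then show ?thesis unfolding q e3 .
    qed
    also have "(exp 3 * (y ^ 3 * d ^ 4)) ^ w \<le> x ^ w"
    proof (rule power_mono)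
      have "y ^ 3 \<le> (1 / d\<^sup>2) ^ 3" using yd y0 by (intro power_mono) auto
      then have "y ^ 3 * d ^ 4 \<le> (1 / d\<^sup>2) ^ 3 * d ^ 4" using dpos by (intro mult_right_mono) auto
      also have "\<dots> = 1 / d\<^sup>2" using dpos by (simp add: field_simps power_numeral_reduce)
      finally have "y ^ 3 * d ^ 4 \<le> 1 / d\<^sup>2" .
      from mult_left_mono[OF this, of "exp 3"] show "exp 3 * (y ^ 3 * d ^ 4) \<le> x" by (simp add: x_def)
    qed (use y0 dpos in auto)
    finally show "real (card {1..n} choose w) * t w \<le> x ^ w" .
  qed
  also have "\<dots> \<le> (\<Sum>w\<in>{1..n}. x ^ w)"
    by (intro sum_mono2) (auto simp: J_def x_def)
  also have "\<dots> \<le> 2 * x"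
    using d_large dpos by (intro sum_power_le_twice) (auto simp: x_def field_simps)
  finally show ?thesis by (simp add: x_def)
qed

section \<open>Degrees and the first layer\<close>

text \<open>\<open>nbrs n E {v} {v}\<close> is the ordinary neighbourhood of \<open>v\<close>, so
  the generating function for \<open>nbrs\<close> covers degrees too.\<close>

definition low_degree :: "nat \<Rightarrow> real \<Rightarrow> nat set set \<Rightarrow> nat set" where
  "low_degree n b E = {v \<in> {1..n}. real (card (nbrs n E {v} {v})) < b}"

lemma (in sparse_gnp) degree_lower_tail:
  assumes v: "v \<in> {1..n}" and l: "0 \<le> l"
  shows "prb (all_edges n) p (\<lambda>E. real (card (nbrs n E {v} {v})) < b) \<le> exp (l * b - (1 - exp (- l)) * d)"
proof -
  have "prb (all_edges n) p (\<lambda>E. real (card (nbrs n E {v} {v})) < b)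
      \<le> expect (all_edges n) p (\<lambda>E. exp (- l) ^ card (nbrs n E {v} {v})) / exp (- (l * b))"
  proof (rule prb_le_expect[OF p0 p1])
    fix E assume "real (card (nbrs n E {v} {v})) < b"
    then have "l * real (card (nbrs n E {v} {v})) \<le> l * b" using l by (intro mult_left_mono) auto
    then show "exp (- (l * b)) \<le> exp (- l) ^ card (nbrs n E {v} {v})"
      unfolding exp_of_nat_mult[symmetric] by (simp add: mult_ac)
  qed auto
  also have "expect (all_edges n) p (\<lambda>E. exp (- l) ^ card (nbrs n E {v} {v}))
      = (1 + (exp (- l) - 1) * (1 - (1 - p) ^ card {v})) ^ (n - card {v})"
    by (rule expect_power_nbrs) (use v in auto)
  also have "\<dots> = (1 + - ((1 - exp (- l)) * p)) ^ (n - 1)" by (simp add: algebra_simps)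
  also have "\<dots> \<le> exp (- ((1 - exp (- l)) * p)) ^ (n - 1)"
  proof (rule power_mono[OF exp_ge_add_one_self])
    have "(1 - exp (- l)) * p \<le> 1 * 1" using l p0 p1 by (intro mult_mono) auto
    then show "0 \<le> 1 + - ((1 - exp (- l)) * p)" by simp
  qed
  also have "\<dots> = exp (- ((1 - exp (- l)) * d))"
    unfolding exp_of_nat_mult[symmetric] p_times[symmetric] using n2 by (simp add: of_nat_diff mult_ac)
  finally have "prb (all_edges n) p (\<lambda>E. real (card (nbrs n E {v} {v})) < b)
      \<le> exp (- ((1 - exp (- l)) * d)) / exp (- (l * b))"
    by (simp add: divide_right_mono)
  then show ?thesis by (simp add: exp_diff[symmetric] algebra_simps)
qed

text \<open>Markov's inequality for the number of such vertices. \<open>l\<close> stays free, to be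
  tuned at the end so that the exponent comes close to \<open>- d\<close>.\<close>

lemma (in sparse_gnp) many_low_degree_prob:
  assumes l: "0 \<le> l"
  shows "prb (all_edges n) p (\<lambda>E. sqrt (real n) \<le> real (card (low_degree n b E)))
       \<le> sqrt (real n) * exp (l * b - (1 - exp (- l)) * d)"
proof -
  let ?x = "exp (l * b - (1 - exp (- l)) * d)"
  have npos: "0 < sqrt (real n)" using n2 by simp
  have c: "real (card (low_degree n b E)) = (\<Sum>v\<in>{1..n}. of_bool (real (card (nbrs n E {v} {v})) < b))" for E
    unfolding low_degree_def by (simp add: Int_def conj_commute)
  have "prb (all_edges n) p (\<lambda>E. sqrt (real n) \<le> real (card (low_degree n b E)))
      \<le> expect (all_edges n) p (\<lambda>E. real (card (low_degree n b E))) / sqrt (real n)"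
    using npos by (intro prb_le_expect p0 p1) auto
  also have "expect (all_edges n) p (\<lambda>E. real (card (low_degree n b E)))
      = (\<Sum>v\<in>{1..n}. prb (all_edges n) p (\<lambda>E. real (card (nbrs n E {v} {v})) < b))"
    unfolding c expect_sum prb_def ..
  also have "\<dots> \<le> (\<Sum>v\<in>{1..n}. ?x)" by (intro sum_mono degree_lower_tail l)
  also have "\<dots> = real n * ?x" by simp
  finally have "prb (all_edges n) p (\<lambda>E. sqrt (real n) \<le> real (card (low_degree n b E)))
      \<le> real n * ?x / sqrt (real n)" using npos by (simp add: divide_right_mono)
  also have "\<dots> = sqrt (real n) * ?x" using npos by (simp add: field_simps)
  finally show ?thesis .
qed

text \<open>Every edge at \<open>S\<close> lies inside the closed neighbourhood and is counted at
  most twice. Splitting the ordered pairs by which entry is larger makes \<open>{v, w}\<close>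
  injective on each half.\<close>

lemma sum_degrees_le:
  assumes E: "E \<subseteq> all_edges n" and S: "S \<subseteq> {1..n}"
  shows "(\<Sum>v\<in>S. card (nbrs n E {v} {v})) \<le> 2 * card (E \<inter> Pow (reach E 1 S))"
proof -
  have finS: "finite S" using S by (rule finite_subset) simp
  define P where "P = (SIGMA v:S. nbrs n E {v} {v})"
  define e :: "nat \<times> nat \<Rightarrow> nat set" where "e = (\<lambda>(v, w). {v, w})"
  have finP: "finite P" using finS by (auto simp: P_def)
  have cP: "card P = (\<Sum>v\<in>S. card (nbrs n E {v} {v}))"
    unfolding P_def using finS by (intro card_SigmaI) auto
  have eP: "e vw \<in> E \<inter> Pow (reach E 1 S)" if "vw \<in> P" for vw
  proof -
    obtain v w where vw: "vw = (v, w)" "v \<in> S" "{v, w} \<in> E" using \<open>vw \<in> P\<close> by (auto simp: P_def nbrs_def)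
    then have "v \<in> reach E 1 S" "w \<in> reach E 1 S"
      by (auto simp: reach_Suc lazy_step_def step_ok_def)
    then show ?thesis using vw by (simp add: e_def)
  qed
  have fin: "finite (E \<inter> Pow (reach E 1 S))"
    using E finite_subset[OF _ finite_all_edges] by blast
  have "card {vw\<in>P. fst vw < snd vw} \<le> card (E \<inter> Pow (reach E 1 S))"
    by (rule card_inj_on_le[of e]) (use eP fin in \<open>auto simp: e_def inj_on_def doubleton_eq_iff\<close>)
  moreover have "card {vw\<in>P. snd vw < fst vw} \<le> card (E \<inter> Pow (reach E 1 S))"
    by (rule card_inj_on_le[of e]) (use eP fin in \<open>auto simp: e_def inj_on_def doubleton_eq_iff\<close>)
  moreover have "P = {vw\<in>P. fst vw < snd vw} \<union> {vw\<in>P. snd vw < fst vw}"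
    by (auto simp: P_def nbrs_def)
  then have "card P \<le> card {vw\<in>P. fst vw < snd vw} + card {vw\<in>P. snd vw < fst vw}"
    by (metis card_Un_le)
  ultimately show ?thesis using cP by linarith
qed

text \<open>With a smaller first layer, \<open>W\<close> would have at most
  \<open>2 \<kappa> d\<close> vertices per vertex of \<open>S\<close>, while the degrees in
  \<open>S\<close> sum to at least eight times that bound. Then \<open>W\<close> would span at least
  four edges per vertex, against sparsity. This is the origin of the 16 in the degree
  threshold.\<close>

lemma (in sparse_gnp) first_layer_large:
  assumes E: "E \<subseteq> all_edges n" and S: "S \<subseteq> {1..n}" "S \<noteq> {}" "S \<inter> low_degree n (16 * \<kappa> * d) E = {}"
    and sp: "locally_sparse n d E" and \<kappa>: "1 \<le> \<kappa> * d" and small: "2 * \<kappa> * real (card S) * d ^ 3 \<le> real n"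
  shows "\<kappa> * d * real (card S) \<le> real (card (layer E S 1))"
proof (rule ccontr)
  assume neg: "\<not> \<kappa> * d * real (card S) \<le> real (card (layer E S 1))"
  have finS: "finite S" using S(1) by (rule finite_subset) simp
  define W where "W = reach E 1 S"
  have W: "W = S \<union> layer E S 1"
    using inner_Un_layer[of E S 1] by (simp add: W_def inner_def)
  have "card W \<le> card S + card (layer E S 1)" unfolding W by (rule card_Un_le)
  moreover have "1 * real (card S) \<le> \<kappa> * d * real (card S)" using \<kappa> by (intro mult_right_mono) auto
  ultimately have cW: "real (card W) \<le> 2 * \<kappa> * d * real (card S)" using neg by linarith
  have WV: "W \<subseteq> {1..n}" unfolding W_def by (rule reach_subset_V[OF E S(1)])
  have "real (card W) * d\<^sup>2 \<le> (2 * \<kappa> * d * real (card S)) * d\<^sup>2"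
    using cW by (intro mult_right_mono) auto
  also have "\<dots> = 2 * \<kappa> * real (card S) * d ^ 3" by (simp add: power2_eq_square power3_eq_cube)
  finally have "real (card W) * d\<^sup>2 \<le> real n" using small by linarith
  then have "card (E \<inter> Pow W) < 4 * card W"
    using sp WV S(2) unfolding locally_sparse_def W by auto
  moreover have "(\<Sum>v\<in>S. card (nbrs n E {v} {v})) \<le> 2 * card (E \<inter> Pow W)"
    unfolding W_def by (rule sum_degrees_le[OF E S(1)])
  ultimately have "(\<Sum>v\<in>S. card (nbrs n E {v} {v})) < 8 * card W" by linarith
  then have "(\<Sum>v\<in>S. real (card (nbrs n E {v} {v}))) < 8 * real (card W)"
    by (metis of_nat_less_iff of_nat_mult of_nat_numeral of_nat_sum)
  moreover have "(\<Sum>v\<in>S. 16 * \<kappa> * d) \<le> (\<Sum>v\<in>S. real (card (nbrs n E {v} {v})))"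
  proof (rule sum_mono)
    fix v assume "v \<in> S"
    then have "v \<notin> low_degree n (16 * \<kappa> * d) E" "v \<in> {1..n}" using S by auto
    then show "16 * \<kappa> * d \<le> real (card (nbrs n E {v} {v}))" by (simp add: low_degree_def)
  qed
  moreover have "8 * real (card W) \<le> (\<Sum>v\<in>S. 16 * \<kappa> * d)" using cW by (simp add: mult_ac)
  ultimately show False by linarith
qed

section \<open>Random starting positions of the cops\<close>

lemma random_subset_lower_tail:
  assumes "finite V" "Y \<subseteq> V" "0 \<le> q" "q \<le> 1"
  shows "prb V q (\<lambda>C. real (card (C \<inter> Y)) \<le> q * real (card Y) / 2) \<le> exp (- (q * real (card Y) / 16))"
proof -
  \<comment> \<open>At this base \<open>1 - ?z \<ge> 3 / 16\<close>, while the threshold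
    \<open>?m / 2\<close> costs \<open>?m / 8\<close>; the difference of the rates is
    \<open>1 / 16\<close>.\<close>
  let ?z = "exp (- (1 / 4)) :: real" and ?m = "q * real (card Y)"
  have z: "?z \<le> 13 / 16" using exp_minus_le_quadratic[of "1 / 4"] by (simp add: power2_eq_square)
  have "prb V q (\<lambda>C. real (card (C \<inter> Y)) \<le> ?m / 2)
      \<le> expect V q (\<lambda>C. ?z ^ card (C \<inter> Y)) / exp (- (?m / 8))"
  proof (rule prb_le_expect)
    fix C assume "real (card (C \<inter> Y)) \<le> ?m / 2"
    then show "exp (- (?m / 8)) \<le> ?z ^ card (C \<inter> Y)"
      unfolding exp_of_nat_mult[symmetric] by simp
  qed (use assms in auto)
  also have "expect V q (\<lambda>C. ?z ^ card (C \<inter> Y)) = (1 + (?z - 1) * q) ^ card Y"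
    by (rule expect_power_card) (use assms in auto)
  also have "\<dots> \<le> exp (- (3 / 16) * q) ^ card Y"
  proof (rule power_mono)
    have "(?z - 1) * q \<le> - (3 / 16) * q" using z assms by (intro mult_right_mono) auto
    then show "1 + (?z - 1) * q \<le> exp (- (3 / 16) * q)"
      using exp_ge_add_one_self[of "- (3 / 16) * q"] by linarith
    have "(1 - ?z) * q \<le> 1 * 1" using assms by (intro mult_mono) auto
    then show "0 \<le> 1 + (?z - 1) * q" by (simp add: algebra_simps)
  qed
  also have "\<dots> = exp (- (3 / 16) * ?m)" unfolding exp_of_nat_mult[symmetric] by (simp add: mult_ac)
  finally have "prb V q (\<lambda>C. real (card (C \<inter> Y)) \<le> ?m / 2) \<le> exp (- (3 / 16) * ?m) / exp (- (?m / 8))"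
    by (simp add: divide_right_mono)
  also have "\<dots> = exp (- (?m / 16))" by (simp add: exp_diff[symmetric])
  finally show ?thesis .
qed

lemma random_subset_size_tail:
  assumes "finite V" "0 \<le> q" "q \<le> 1" and large: "1 \<le> q * real (card V)"
  shows "prb V q (\<lambda>C. 4 * q * real (card V) \<le> real (card C)) \<le> 1 / 4"
proof -
  let ?m = "q * real (card V)"
  have "prb V q (\<lambda>C. 4 * q * real (card V) \<le> real (card C))
      \<le> expect V q (\<lambda>C. exp 1 ^ card (C \<inter> V)) / exp (4 * ?m)"
  proof (rule prb_le_expect)
    fix C assume "C \<subseteq> V" "4 * q * real (card V) \<le> real (card C)"
    moreover from this have "C \<inter> V = C" by blast
    ultimately show "exp (4 * ?m) \<le> exp 1 ^ card (C \<inter> V)"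
      unfolding exp_of_nat_mult[symmetric] by simp
  qed (use assms in auto)
  also have "expect V q (\<lambda>C. exp 1 ^ card (C \<inter> V)) = (1 + (exp 1 - 1) * q) ^ card V"
    by (rule expect_power_card) (use assms in auto)
  also have "\<dots> \<le> exp (2 * q) ^ card V"
  proof (rule power_mono)
    have "(exp 1 - 1) * q \<le> 2 * q" using exp_le assms by (intro mult_right_mono) auto
    then show "1 + (exp 1 - 1) * q \<le> exp (2 * q)"
      using exp_ge_add_one_self[of "2 * q"] by linarith
    have "0 \<le> (exp 1 - 1) * q" using assms by simp
    then show "0 \<le> 1 + (exp 1 - 1) * q" by linarith
  qed
  also have "\<dots> = exp (2 * ?m)" unfolding exp_of_nat_mult[symmetric] by (simp add: mult_ac)
  finally have "prb V q (\<lambda>C. 4 * q * real (card V) \<le> real (card C)) \<le> exp (2 * ?m) / exp (4 * ?m)"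
    by (simp add: divide_right_mono)
  also have "\<dots> = exp (- (2 * ?m))" by (simp add: exp_diff[symmetric])
  also have "\<dots> \<le> exp (- (2 * 1))" using large by simp
  also have "\<dots> \<le> 1 / 4"
  proof -
    have "(2::real) * 2 \<le> exp 1 * exp 1"
      using exp_ge_add_one_self[of 1] by (intro mult_mono) auto
    then have "4 \<le> exp (2::real)" by (simp add: exp_add[symmetric])
    then show ?thesis by (simp add: exp_minus field_simps)
  qed
  finally show ?thesis .
qed

text \<open>The probabilistic method: \<open>C\<close> is too large with probability at most 1/4 and
  misses some target with probability at most 1/2, so a good \<open>C\<close> exists.\<close>

lemma exists_hitting_set:
  assumes V: "finite V" and q: "0 \<le> q" "q \<le> 1" "1 \<le> q * real (card V)"
    and I: "finite I" "\<And>i. i \<in> I \<Longrightarrow> Y i \<subseteq> V"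
    and sum: "(\<Sum>i\<in>I. exp (- (q * real (card (Y i)) / 16))) \<le> 1 / 2"
  shows "\<exists>C\<subseteq>V. real (card C) \<le> 4 * q * real (card V)
      \<and> (\<forall>i\<in>I. q * real (card (Y i)) / 2 < real (card (C \<inter> Y i)))"
proof (rule ccontr)
  assume neg: "\<not> ?thesis"
  have "1 = prb V q (\<lambda>C. True)" using V by (simp add: prb_def)
  also have "\<dots> \<le> prb V q (\<lambda>C. 4 * q * real (card V) \<le> real (card C)
      \<or> (\<exists>i\<in>I. real (card (C \<inter> Y i)) \<le> q * real (card (Y i)) / 2))"
  proof (rule prb_mono)
    fix C assume "C \<subseteq> V"
    then show "4 * q * real (card V) \<le> real (card C)
      \<or> (\<exists>i\<in>I. real (card (C \<inter> Y i)) \<le> q * real (card (Y i)) / 2)"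
      using neg by (meson linorder_le_less_linear less_imp_le)
  qed (use q in auto)
  also have "\<dots> \<le> prb V q (\<lambda>C. 4 * q * real (card V) \<le> real (card C))
      + prb V q (\<lambda>C. \<exists>i\<in>I. real (card (C \<inter> Y i)) \<le> q * real (card (Y i)) / 2)"
    by (rule prb_disj_le) (use q in auto)
  also have "prb V q (\<lambda>C. \<exists>i\<in>I. real (card (C \<inter> Y i)) \<le> q * real (card (Y i)) / 2)
      \<le> (\<Sum>i\<in>I. prb V q (\<lambda>C. real (card (C \<inter> Y i)) \<le> q * real (card (Y i)) / 2))"
    by (rule prb_Bex_le) (use q I in auto)
  also have "\<dots> \<le> (\<Sum>i\<in>I. exp (- (q * real (card (Y i)) / 16)))"
    using V I q by (intro sum_mono random_subset_lower_tail) auto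
  also have "\<dots> \<le> 1 / 2" by (rule sum)
  finally show False using random_subset_size_tail[OF V q(1,2,3)] by linarith
qed

section \<open>Cop number of expanding graphs\<close>

lemma half_le_nat_floor:
  fixes x :: real
  assumes "1 \<le> x"
  shows "x / 2 \<le> real (nat \<lfloor>x\<rfloor>)" "real (nat \<lfloor>x\<rfloor>) \<le> x" "1 \<le> nat \<lfloor>x\<rfloor>"
proof -
  have f: "1 \<le> \<lfloor>x\<rfloor>" using assms by (simp add: le_floor_iff)
  then have "(1::real) \<le> of_int \<lfloor>x\<rfloor>" by simp
  moreover have "x < of_int \<lfloor>x\<rfloor> + 1" "of_int \<lfloor>x\<rfloor> \<le> x" by linarith+
  moreover have "real (nat \<lfloor>x\<rfloor>) = of_int \<lfloor>x\<rfloor>" using f by simp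
  ultimately show "x / 2 \<le> real (nat \<lfloor>x\<rfloor>)" "real (nat \<lfloor>x\<rfloor>) \<le> x" by linarith+
  show "1 \<le> nat \<lfloor>x\<rfloor>" using f by linarith
qed

lemma exp_le_inverse_cube_power:
  assumes "1 \<le> n" "ln (real n) \<le> 2 * d" "6 * d * real k \<le> y"
  shows "exp (- y) \<le> (1 / real n ^ 3) ^ k"
proof -
  have "ln (real n) * real k \<le> (2 * d) * real k" using assms(2) by (rule mult_right_mono) simp
  then have "exp (- y) \<le> exp (real k * (- (3 * ln (real n))))" using assms(3) by (simp add: mult_ac)
  also have "\<dots> = exp (- (3 * ln (real n))) ^ k" by (rule exp_of_nat_mult)
  also have "exp (- (3 * ln (real n))) = 1 / real n ^ 3"
  proof -
    have "exp (3 * ln (real n)) = exp (ln (real n)) ^ 3"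
      using exp_of_nat_mult[of 3 "ln (real n)"] by simp
    then show ?thesis using assms(1) by (simp add: exp_minus inverse_eq_divide)
  qed
  finally show ?thesis .
qed

lemma sum_nonempty_subsets_le:
  assumes n2: "2 \<le> n" and A: "A \<subseteq> Pow {1..n} - {{}}"
  shows "(\<Sum>S\<in>A. (1 / real n ^ 3) ^ card S) \<le> 2 / real n ^ 2"
proof -
  have "(\<Sum>S\<in>A. (1 / real n ^ 3) ^ card S) \<le> (\<Sum>w\<in>{1..n}. real (card {1..n} choose w) * (1 / real n ^ 3) ^ w)"
  proof (rule sum_subsets_by_card)
    show "card ` A \<subseteq> {1..n}"
    proof
      fix w assume "w \<in> card ` A"
      then obtain S where S: "S \<subseteq> {1..n}" "S \<noteq> {}" "w = card S" using A by auto
      have "finite S" using S(1) by (rule finite_subset) simp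
      then have "1 \<le> card S" using S(2) by (simp add: Suc_le_eq card_gt_0_iff)
      moreover have "card S \<le> n" using card_mono[OF _ S(1)] by simp
      ultimately show "w \<in> {1..n}" using S(3) by simp
    qed
  qed (use A in auto)
  also have "\<dots> \<le> (\<Sum>w\<in>{1..n}. (1 / real n ^ 2) ^ w)"
  proof (rule sum_mono)
    fix w assume "w \<in> {1..n}"
    have "real (card {1..n} choose w) * (1 / real n ^ 3) ^ w \<le> real n ^ w * (1 / real n ^ 3) ^ w"
      using binomial_le_power_real[of n w] by (intro mult_right_mono) auto
    also have "\<dots> = (real n * (1 / real n ^ 3)) ^ w" by (simp only: power_mult_distrib)
    also have "real n * (1 / real n ^ 3) = 1 / real n ^ 2"
      using n2 by (simp add: power2_eq_square power3_eq_cube)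
    finally show "real (card {1..n} choose w) * (1 / real n ^ 3) ^ w \<le> (1 / real n ^ 2) ^ w" .
  qed
  also have "\<dots> \<le> 2 * (1 / real n ^ 2)"
  proof (rule sum_power_le_twice)
    have "2 * 1 \<le> real n * real n" using n2 by (intro mult_mono) auto
    then show "1 / real n ^ 2 \<le> 1 / 2" using n2 by (simp add: power2_eq_square field_simps)
  qed simp
  finally show ?thesis by simp
qed

text \<open>The graph is fixed here and the cops have density \<open>\<gamma> / sqrt n\<close>. By
  \<open>\<gamma> * c * c0 = 96 * K1\<close>, at least \<open>48 * K1 * d ^ r\<close> of them are
  expected within \<open>Suc r\<close> moves of any \<open>s1\<close> vertices outside
  \<open>Z\<close>. Half of this still exceeds a ball, and the failure bound
  \<open>exp (- 3 * K1 * d ^ r)\<close> beats the at most \<open>n * exp (K1 * d ^ r)\<close>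
  relevant sets.\<close>

lemma cop_number_le_of_expansion:
  fixes n r :: nat and d K1 c c0 \<gamma> :: real
  assumes E: "E \<subseteq> all_edges n" and Z: "Z \<subseteq> {1..n}" "real (card Z) \<le> sqrt (real n)"
    and n4: "4 \<le> n" and d4: "4 \<le> d" and lnd: "ln (real n) \<le> 2 * d"
    and r: "d ^ r \<le> sqrt (real n)" "sqrt (real n) < d * d ^ r"
    and const_rel: "1 \<le> K1" "0 < c" "0 < c0" "c0 \<le> 1" "0 < \<gamma>" "\<gamma> * c * c0 = 96 * K1"
    and growth: "\<And>v. v \<in> {1..n} \<Longrightarrow> real (card (reach E r {v})) \<le> K1 * d ^ r"
      "\<And>v. v \<in> {1..n} \<Longrightarrow> real (card (reach E 1 {v})) \<le> K1 * d"
    and expand: "\<And>S j. S \<subseteq> {1..n} - Z \<Longrightarrow> S \<noteq> {} \<Longrightarrow> j \<in> {Suc r, Suc (Suc r)} \<Longrightarrow>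
      real (card S) * d ^ j \<le> c0 * real n \<Longrightarrow> c * real (card S) * d ^ j \<le> real (card (reach E j S))"
    and large: "d\<^sup>2 \<le> c0 * sqrt (real n)" "ln (4 * real n) \<le> sqrt (real n) / d"
      "\<gamma> \<le> sqrt (real n)" "1 \<le> \<gamma> * sqrt (real n)"
  shows "real (cop_number {1..n} E) \<le> (1 + 8 * \<gamma>) * sqrt (real n)"
proof -
  define R where "R = sqrt (real n)"
  have RR: "R * R = real n" by (simp add: R_def)
  have R0: "0 < R" and d0: "0 < d" using n4 d4 by (auto simp: R_def)
  note r = r[folded R_def] and large = large[folded R_def]
  define X where "X = d ^ r"
  have X0: "0 < X" using d0 by (simp add: X_def)
  have Xr: "X \<le> R" "R < d * X" using r by (auto simp: X_def)
  define q where "q = \<gamma> / R"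
  have q: "0 \<le> q" "q \<le> 1" "q * real n = \<gamma> * R"
    using const_rel large(3) R0 RR by (auto simp: q_def field_simps)
  \<comment> \<open>Size limits for \<open>expand\<close>: \<open>x2\<close> is exact for radius
    \<open>Suc (Suc r)\<close>; \<open>x1\<close> is safe for radius \<open>Suc r\<close> because
    \<open>d ^ r \<le> R\<close>, and keeps the total size of \<open>s1\<close> closed
    neighbourhoods below \<open>K1 * R\<close>.\<close>
  define x1 where "x1 = c0 * R / d"
  define x2 where "x2 = c0 * real n / d ^ Suc (Suc r)"
  define s1 where "s1 = nat \<lfloor>x1\<rfloor>"
  define s2 where "s2 = nat \<lfloor>x2\<rfloor>"
  have dd: "d * 1 \<le> d * d" using d4 by (intro mult_left_mono) auto
  then have "d \<le> c0 * R" using large(1) by (simp add: power2_eq_square)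
  then have x1: "1 \<le> x1" using d0 by (simp add: x1_def)
  have x2: "1 \<le> x2"
  proof -
    have "d ^ Suc (Suc r) = d\<^sup>2 * X" by (simp add: X_def power2_eq_square)
    also have "\<dots> \<le> (c0 * R) * R" using large(1) Xr X0 const_rel R0 by (intro mult_mono) auto
    also have "\<dots> = c0 * real n" using RR by simp
    finally show ?thesis using d0 by (simp add: x2_def)
  qed
  note s1 = half_le_nat_floor[OF x1, folded s1_def] and s2 = half_le_nat_floor[OF x2, folded s2_def]
  have gcc: "96 \<le> \<gamma> * c"
  proof -
    have "\<gamma> * c * c0 \<le> \<gamma> * c * 1" using const_rel by (intro mult_left_mono) auto
    then show ?thesis using const_rel by simp
  qed
  have Y1: "48 * K1 * X \<le> q * real (card (reach E (Suc r) S))"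
    if S: "S \<subseteq> {1..n} - Z" "card S = s1" for S
  proof -
    have ne: "S \<noteq> {}" using S s1(3) by auto
    have "real s1 * d ^ Suc r \<le> x1 * d ^ Suc r" using s1 d0 by (intro mult_right_mono) auto
    also have "\<dots> = c0 * R * X" using d0 by (simp add: x1_def X_def)
    also have "\<dots> \<le> c0 * R * R" using Xr const_rel R0 by (intro mult_left_mono) auto
    finally have "real (card S) * d ^ Suc r \<le> c0 * real n" using RR S by (simp add: mult.assoc)
    then have e: "c * real (card S) * d ^ Suc r \<le> real (card (reach E (Suc r) S))"
      using expand[OF S(1) ne, of "Suc r"] by simp
    have "48 * K1 * X = q * (c * (x1 / 2) * d ^ Suc r)"
    proof -
      have "q * (c * (x1 / 2) * d ^ Suc r) = (\<gamma> * c * c0) * X / 2"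
        using R0 d0 by (simp add: q_def x1_def X_def field_simps)
      then show ?thesis using const_rel by simp
    qed
    also have "\<dots> \<le> q * (c * real (card S) * d ^ Suc r)"
      using s1 S const_rel q d0 by (intro mult_left_mono mult_right_mono) auto
    also have "\<dots> \<le> q * real (card (reach E (Suc r) S))" using e q by (intro mult_left_mono) auto
    finally show ?thesis .
  qed
  have Y2: "q * (c * real (card S) * d ^ Suc (Suc r)) \<le> q * real (card (reach E (Suc (Suc r)) S))"
    if S: "S \<subseteq> {1..n} - Z" "S \<noteq> {}" "card S \<le> s2" for S
  proof -
    have "real (card S) \<le> x2" using S(3) s2 by linarith
    then have "real (card S) * d ^ Suc (Suc r) \<le> c0 * real n" using d0 by (simp add: x2_def field_simps)
    then have "c * real (card S) * d ^ Suc (Suc r) \<le> real (card (reach E (Suc (Suc r)) S))"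
      using expand[OF S(1,2), of "Suc (Suc r)"] by simp
    then show ?thesis using q by (intro mult_left_mono) auto
  qed
  \<comment> \<open>The other side \<open>R < d * d ^ r\<close> of the choice of \<open>r\<close>
    enters here. With at least \<open>96 * d\<close> expected cops per vertex, a union bound over
    all vertex sets of admissible size is affordable.\<close>
  have Y2': "96 * d * real (card S) \<le> q * (c * real (card S) * d ^ Suc (Suc r))" for S :: "nat set"
  proof -
    have "96 * (d * real (card S)) \<le> (\<gamma> * c) * (d * real (card S))"
      using gcc d0 by (intro mult_right_mono) auto
    also have "\<dots> = q * (c * real (card S) * (d * R))" using R0 by (simp add: q_def)
    also have "\<dots> \<le> q * (c * real (card S) * (d * (d * X)))"
      using Xr q const_rel d0 by (intro mult_left_mono) auto
    finally show ?thesis by (simp add: X_def)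
  qed
  define A1 where "A1 = {S. \<exists>v\<in>{1..n}. S \<subseteq> reach E r {v} - Z \<and> card S = s1}"
  define A2 where "A2 = {S. S \<subseteq> {1..n} - Z \<and> S \<noteq> {} \<and> card S \<le> s2}"
  \<comment> \<open>The radius is kept as a tag, as one set may belong to both families.\<close>
  define I where "I = {Suc r} \<times> A1 \<union> {Suc (Suc r)} \<times> A2"
  have A1V: "S \<subseteq> {1..n} - Z" if "S \<in> A1" for S
    using that reach_subset_V[OF E, of "{_}" r] unfolding A1_def by blast
  have finA: "finite A1" "finite A2"
    by (rule finite_subset[of _ "Pow {1..n}"]; use A1V in \<open>force simp: A2_def\<close>)+
  have sum1: "(\<Sum>S\<in>A1. exp (- (q * real (card (reach E (Suc r) S)) / 16))) \<le> 1 / 4"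
  proof -
    have "(\<Sum>S\<in>A1. exp (- (q * real (card (reach E (Suc r) S)) / 16))) \<le> (\<Sum>S\<in>A1. exp (- (3 * K1 * X)))"
    proof (rule sum_mono)
      fix S assume "S \<in> A1"
      then have "48 * K1 * X \<le> q * real (card (reach E (Suc r) S))"
        using A1V by (intro Y1) (auto simp: A1_def)
      then show "exp (- (q * real (card (reach E (Suc r) S)) / 16)) \<le> exp (- (3 * K1 * X))" by simp
    qed
    also have "\<dots> = real (card A1) * exp (- (3 * K1 * X))" by simp
    also have "\<dots> \<le> (real n * exp (K1 * X)) * exp (- (3 * K1 * X))"
    proof (rule mult_right_mono)
      have "A1 \<subseteq> (\<Union>v\<in>{1..n}. Pow (reach E r {v}))" unfolding A1_def by auto
      then have "card A1 \<le> card (\<Union>v\<in>{1..n}. Pow (reach E r {v}))"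
        using finite_reach[OF E] by (intro card_mono) auto
      also have "\<dots> \<le> (\<Sum>v\<in>{1..n}. card (Pow (reach E r {v})))" by (rule card_UN_le) simp
      finally have "real (card A1) \<le> (\<Sum>v\<in>{1..n}. real (card (Pow (reach E r {v}))))"
        by (metis of_nat_le_iff of_nat_sum)
      also have "\<dots> \<le> (\<Sum>v\<in>{1..n}. exp (K1 * X))"
      proof (rule sum_mono)
        fix v assume v: "v \<in> {1..n}"
        have "real (card (Pow (reach E r {v}))) = 2 ^ card (reach E r {v})"
          using finite_reach[OF E, of "{v}" r] v by (simp add: card_Pow)
        also have "\<dots> \<le> exp 1 ^ card (reach E r {v})"
          using exp_ge_add_one_self[of 1] by (intro power_mono) auto
        also have "\<dots> = exp (real (card (reach E r {v})))" by (simp add: exp_of_nat_mult[symmetric])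
        also have "\<dots> \<le> exp (K1 * X)" using growth(1)[OF v] by (simp add: X_def)
        finally show "real (card (Pow (reach E r {v}))) \<le> exp (K1 * X)" .
      qed
      also have "\<dots> = real n * exp (K1 * X)" by simp
      finally show "real (card A1) \<le> real n * exp (K1 * X)" .
    qed simp
    also have "\<dots> = real n * exp (- (2 * K1 * X))" by (simp add: exp_add[symmetric])
    also have "\<dots> \<le> real n * exp (- ln (4 * real n))"
    proof -
      \<comment> \<open>Even in the worst position of \<open>sqrt n\<close> between two powers of
        \<open>d\<close>, the exponent \<open>X\<close> dominates \<open>ln (4 * n)\<close> and pays
        for the choice of the centre.\<close>
      have "R / d \<le> X" using Xr d0 by (simp add: field_simps)
      moreover have "1 * X \<le> (2 * K1) * X" using const_rel X0 by (intro mult_right_mono) auto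
      ultimately have "ln (4 * real n) \<le> 2 * K1 * X" using large(2) by linarith
      then show ?thesis by (intro mult_left_mono) auto
    qed
    also have "\<dots> = 1 / 4" using n4 by (simp add: exp_minus)
    finally show ?thesis .
  qed
  have sum2: "(\<Sum>S\<in>A2. exp (- (q * real (card (reach E (Suc (Suc r)) S)) / 16))) \<le> 1 / 4"
  proof -
    have "(\<Sum>S\<in>A2. exp (- (q * real (card (reach E (Suc (Suc r)) S)) / 16)))
        \<le> (\<Sum>S\<in>A2. (1 / real n ^ 3) ^ card S)"
    proof (rule sum_mono)
      fix S assume "S \<in> A2"
      then have "96 * d * real (card S) \<le> q * real (card (reach E (Suc (Suc r)) S))"
        using Y2[of S] Y2'[of S] by (auto simp: A2_def)
      then show "exp (- (q * real (card (reach E (Suc (Suc r)) S)) / 16)) \<le> (1 / real n ^ 3) ^ card S"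
        using n4 by (intro exp_le_inverse_cube_power[OF _ lnd]) auto
    qed
    also have "\<dots> \<le> 2 / real n ^ 2"
      using n4 by (intro sum_nonempty_subsets_le) (auto simp: A2_def)
    also have "\<dots> \<le> 1 / 4"
    proof -
      have "4 * 4 \<le> real n * real n" using n4 by (intro mult_mono) auto
      then show ?thesis using n4 by (simp add: power2_eq_square field_simps)
    qed
    finally show ?thesis .
  qed
  have "\<exists>C\<subseteq>{1..n}. real (card C) \<le> 4 * q * real (card {1..n}) \<and>
      (\<forall>jS\<in>I. q * real (card (reach E (fst jS) (snd jS))) / 2 < real (card (C \<inter> reach E (fst jS) (snd jS))))"
  proof (rule exists_hitting_set)
    show "1 \<le> q * real (card {1..n})" using q(3) large(4) by simp
    show "finite I" using finA by (simp add: I_def)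
    show "reach E (fst jS) (snd jS) \<subseteq> {1..n}" if "jS \<in> I" for jS
    proof (rule reach_subset_V[OF E])
      have "snd jS \<in> A1 \<or> snd jS \<subseteq> {1..n} - Z" using that by (auto simp: I_def A2_def)
      then show "snd jS \<subseteq> {1..n}" using A1V by blast
    qed
    have "(\<Sum>jS\<in>I. exp (- (q * real (card (reach E (fst jS) (snd jS))) / 16)))
      = (\<Sum>jS\<in>{Suc r} \<times> A1. exp (- (q * real (card (reach E (fst jS) (snd jS))) / 16)))
      + (\<Sum>jS\<in>{Suc (Suc r)} \<times> A2. exp (- (q * real (card (reach E (fst jS) (snd jS))) / 16)))"
      unfolding I_def using finA by (intro sum.union_disjoint) auto
    also have "(\<Sum>jS\<in>{Suc r} \<times> A1. exp (- (q * real (card (reach E (fst jS) (snd jS))) / 16)))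
      = (\<Sum>S\<in>A1. exp (- (q * real (card (reach E (Suc r) S)) / 16)))"
      using sum.cartesian_product[of "\<lambda>j S. exp (- (q * real (card (reach E j S)) / 16))" A1 "{Suc r}"]
      by (simp add: case_prod_unfold)
    also have "(\<Sum>jS\<in>{Suc (Suc r)} \<times> A2. exp (- (q * real (card (reach E (fst jS) (snd jS))) / 16)))
      = (\<Sum>S\<in>A2. exp (- (q * real (card (reach E (Suc (Suc r)) S)) / 16)))"
      using sum.cartesian_product[of "\<lambda>j S. exp (- (q * real (card (reach E j S)) / 16))" A2 "{Suc (Suc r)}"]
      by (simp add: case_prod_unfold)
    finally show "(\<Sum>jS\<in>I. exp (- (q * real (card (reach E (fst jS) (snd jS))) / 16))) \<le> 1 / 2"
      using sum1 sum2 by linarith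
  qed (use q in auto)
  then obtain C where C: "C \<subseteq> {1..n}" "real (card C) \<le> 4 * q * real (card {1..n})"
    "\<forall>jS\<in>I. q * real (card (reach E (fst jS) (snd jS))) / 2
      < real (card (C \<inter> reach E (fst jS) (snd jS)))"
    by auto
  have C_card: "real (card C) \<le> 4 * (\<gamma> * R)" using C(2) q(3) by (simp add: mult.assoc)
  have C_hit: "q * real (card (reach E j S)) / 2 < real (card (C \<inter> reach E j S))" if "(j, S) \<in> I" for j S
    using bspec[OF C(3) that] by simp
  define D where "D = nat \<lfloor>K1 * d\<rfloor>"
  have Kd: "1 \<le> K1 * d" using mult_mono[of 1 K1 1 d] const_rel d4 by simp
  note D = half_le_nat_floor[OF Kd, folded D_def]
  have M: "real (s1 * D) \<le> K1 * R"
  proof -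
    have "real s1 * real D \<le> x1 * (K1 * d)" using s1 D x1 by (intro mult_mono) auto
    also have "\<dots> = c0 * (K1 * R)" using d0 by (simp add: x1_def)
    also have "\<dots> \<le> 1 * (K1 * R)" using const_rel R0 by (intro mult_right_mono) auto
    finally show ?thesis by simp
  qed
  have "cop_number {1..n} E \<le> card Z + 2 * card C"
  proof (rule two_team_capture[OF E Z(1) C(1)])
    fix v S assume v: "v \<in> {1..n}" and S: "S \<subseteq> reach E r {v} - Z" "card S = s1"
    have A: "S \<in> A1" using v S by (auto simp: A1_def)
    have "real (card (reach E r {v})) \<le> K1 * X" using growth(1)[OF v] by (simp add: X_def)
    also have "\<dots> \<le> (48 * K1 * X) / 2" using const_rel X0 by simp
    also have "\<dots> \<le> q * real (card (reach E (Suc r) S)) / 2"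
      using Y1[OF A1V[OF A] S(2)] by simp
    also have "\<dots> < real (card (C \<inter> reach E (Suc r) S))" using A by (intro C_hit) (auto simp: I_def)
    finally show "card (reach E r {v}) < card (C \<inter> reach E (Suc r) S)" by simp
  next
    fix S assume S: "S \<subseteq> {1..n} - Z" "card S \<le> s1 * D"
    show "card S \<le> card (C \<inter> reach E (Suc (Suc r)) S)"
    proof (cases "card S \<le> s2")
      case small: True
      show ?thesis
      proof (cases "S = {}")
        case False
        have "real (card S) \<le> (96 * d * real (card S)) / 2"
          using mult_right_mono[of 1 "48 * d" "real (card S)"] d4 by simp
        also have "\<dots> \<le> q * real (card (reach E (Suc (Suc r)) S)) / 2"
          using Y2[OF S(1) False small] Y2'[of S] by linarith
        also have "\<dots> < real (card (C \<inter> reach E (Suc (Suc r)) S))"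
          using S False small by (intro C_hit) (auto simp: I_def A2_def)
        finally show ?thesis by simp
      qed simp
    next
      case False
      \<comment> \<open>Beyond \<open>s2\<close> vertices \<open>expand\<close> is out of reach, but
        \<open>s2\<close> of them already see more than \<open>24 * K1 * R\<close> cops, while
        \<open>S\<close> has at most \<open>K1 * R\<close> elements.\<close>
      then obtain S' where S': "S' \<subseteq> S" "card S' = s2"
        using obtain_subset_with_card_n[of s2 S] by auto
      have ne: "S' \<noteq> {}" using S' s2(3) by auto
      have sub: "S' \<subseteq> {1..n} - Z" using S' S by blast
      have "real (card S) \<le> K1 * R" using S(2) M by linarith
      also have "\<dots> \<le> 24 * K1 * R" using const_rel R0 by simp
      also have "\<dots> = q * (c * (x2 / 2) * d ^ Suc (Suc r)) / 2"
      proof -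
        have "q * (c * (x2 / 2) * d ^ Suc (Suc r)) / 2 = q * (c * (c0 * (R * R)) / 4)"
          unfolding RR using d0 by (simp add: x2_def)
        also have "\<dots> = (\<gamma> * c * c0) * R / 4" using R0 by (simp add: q_def)
        finally show ?thesis using const_rel by simp
      qed
      also have "\<dots> \<le> q * (c * real (card S') * d ^ Suc (Suc r)) / 2"
        using s2 S' const_rel q d0 by (intro divide_right_mono mult_left_mono mult_right_mono) auto
      also have "\<dots> \<le> q * real (card (reach E (Suc (Suc r)) S')) / 2"
        using Y2[OF sub ne] S' by simp
      also have "\<dots> < real (card (C \<inter> reach E (Suc (Suc r)) S'))"
        using sub ne S' by (intro C_hit) (auto simp: I_def A2_def)
      also have "\<dots> \<le> real (card (C \<inter> reach E (Suc (Suc r)) S))"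
      proof -
        have "finite C" using C(1) by (rule finite_subset) simp
        then show ?thesis using reach_mono[OF S'(1), of E "Suc (Suc r)"]
          by (intro of_nat_mono card_mono) auto
      qed
      finally show ?thesis by simp
    qed
  next
    fix v assume v: "v \<in> {1..n}"
    show "card (reach E 1 {v}) \<le> D" using growth(2)[OF v] by (simp add: D_def le_nat_floor)
  qed simp
  then have "real (cop_number {1..n} E) \<le> real (card Z) + 2 * real (card C)" by linarith
  also have "\<dots> \<le> R + 2 * (4 * (\<gamma> * R))" using Z(2) C_card by (simp add: R_def)
  finally show ?thesis by (simp add: R_def algebra_simps)
qed

section \<open>Probability estimates and the limit\<close>

context sparse_gnp
begin

lemma reach_card_le:
  assumes E: "E \<subseteq> all_edges n" and v: "v \<in> {1..n}"
    and lay: "\<And>i. i < m \<Longrightarrow> real (card (layer E {v} (Suc i))) < 20 * d ^ Suc i"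
  shows "k \<le> m \<Longrightarrow> real (card (reach E k {v})) \<le> 40 * d ^ k"
proof (induction k)
  case (Suc k)
  have "reach E (Suc k) {v} = reach E k {v} \<union> layer E {v} (Suc k)"
    using inner_Un_layer[of E "{v}" "Suc k"] by (simp only: inner_Suc)
  then have "card (reach E (Suc k) {v}) \<le> card (reach E k {v}) + card (layer E {v} (Suc k))"
    by (simp only: card_Un_le)
  moreover have "real (card (reach E k {v})) \<le> 40 * d ^ k" using Suc by simp
  moreover have "real (card (layer E {v} (Suc k))) < 20 * d ^ Suc k" using Suc.prems lay by simp
  moreover have "2 * d ^ k \<le> d ^ Suc k" using d4 by (simp add: mult_right_mono)
  ultimately show ?case by linarith
qed simp

lemma reach_card_le_set:
  assumes E: "E \<subseteq> all_edges n" and S: "S \<subseteq> {1..n}"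
    and b: "\<And>v. v \<in> S \<Longrightarrow> real (card (reach E k {v})) \<le> x"
  shows "real (card (reach E k S)) \<le> real (card S) * x"
proof -
  have "finite S" using S by (rule finite_subset) simp
  then have "card (reach E k S) \<le> (\<Sum>v\<in>S. card (reach E k {v}))"
    by (subst reach_UN) (rule card_UN_le)
  then have "real (card (reach E k S)) \<le> (\<Sum>v\<in>S. real (card (reach E k {v})))"
    by (metis of_nat_le_iff of_nat_sum)
  also have "\<dots> \<le> (\<Sum>v\<in>S. x)" by (intro sum_mono b)
  finally show ?thesis by simp
qed

text \<open>The constant 20 makes each tail at most \<open>exp (- 8 * d) \<le> n ^ (-4)\<close>,
  against at most \<open>n^2\<close> pairs of a vertex and a layer.\<close>

lemma large_layer_prob:
  assumes lnd: "ln (real n) \<le> 2 * d" and m: "m \<le> n"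
  shows "prb (all_edges n) p (\<lambda>E. \<exists>vi\<in>{1..n} \<times> {..<m}.
      20 * d ^ Suc (snd vi) \<le> real (card (layer E {fst vi} (Suc (snd vi))))) \<le> 1 / real n ^ 2"
proof -
  have "prb (all_edges n) p (\<lambda>E. \<exists>vi\<in>{1..n} \<times> {..<m}.
      20 * d ^ Suc (snd vi) \<le> real (card (layer E {fst vi} (Suc (snd vi)))))
    \<le> (\<Sum>vi\<in>{1..n} \<times> {..<m}. prb (all_edges n) p (\<lambda>E.
      20 * d ^ Suc (snd vi) \<le> real (card (layer E {fst vi} (Suc (snd vi))))))"
    by (rule prb_Bex_le[OF p0 p1]) simp
  also have "\<dots> \<le> (\<Sum>vi\<in>{1..n} \<times> {..<m}. exp (2 * d - 20 * d / 2))"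
    by (intro sum_mono layer_upper_tail) auto
  also have "\<dots> = real n * real m * exp (- (8 * d))" by simp
  also have "\<dots> \<le> real n * real n * exp (- (4 * ln (real n)))"
    using m lnd by (intro mult_mono) auto
  also have "exp (- (4 * ln (real n))) = 1 / real n ^ 4"
  proof -
    have "exp (4 * ln (real n)) = exp (ln (real n)) ^ 4"
      using exp_of_nat_mult[of 4 "ln (real n)"] by simp
    then show ?thesis using n2 by (simp add: exp_minus inverse_eq_divide)
  qed
  also have "real n * real n * (1 / real n ^ 4) = 1 / real n ^ 2"
    using n2 by (simp add: power2_eq_square power4_eq_xxxx)
  finally show ?thesis .
qed

text \<open>The bad event of \<open>layer_lower_tail\<close>. Its first two conjuncts are secured
  separately, by sparsity and by the growth bounds, so excluding the event forces layer
  \<open>j\<close> to be large.\<close>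

definition poor_expansion :: "real \<Rightarrow> nat \<Rightarrow> nat set \<Rightarrow> nat set set \<Rightarrow> bool" where
  "poor_expansion \<kappa> j S E \<longleftrightarrow> \<kappa> * d * real (card S) \<le> real (card (layer E S 1))
     \<and> (\<forall>k<j. real (card (reach E k S)) \<le> real (card S) * 40 * d ^ k)
     \<and> real (card (layer E S j)) \<le> \<kappa> / 4 * real (card S) * d ^ j"

text \<open>Uses \<open>B = 24 / \<kappa>\<close>, which gives
  \<open>exp (- 6 * d * s) \<le> n ^ (-3 s)\<close>; then \<open>192 / \<kappa> = 8 * B\<close> and
  \<open>960 = 24 * 40\<close>.\<close>

lemma poor_expansion_prob:
  assumes lnd: "ln (real n) \<le> 2 * d" and \<kappa>: "0 < \<kappa>" "192 / \<kappa> \<le> d" and j: "1 \<le> j"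
  shows "prb (all_edges n) p (\<lambda>E. \<exists>S \<in> {S \<in> Pow {1..n} - {{}}. 960 * (real (card S) * d ^ j) \<le> real n}.
      poor_expansion \<kappa> j S E) \<le> 2 / real n ^ 2"
proof -
  let ?A = "{S \<in> Pow {1..n} - {{}}. 960 * (real (card S) * d ^ j) \<le> real n}"
  have fin: "finite ?A" by simp
  have "prb (all_edges n) p (\<lambda>E. \<exists>S\<in>?A. poor_expansion \<kappa> j S E)
      \<le> (\<Sum>S\<in>?A. prb (all_edges n) p (poor_expansion \<kappa> j S))"
    by (rule prb_Bex_le[OF p0 p1 fin])
  also have "\<dots> \<le> (\<Sum>S\<in>?A. (1 / real n ^ 3) ^ card S)"
  proof (rule sum_mono)
    fix S assume S: "S \<in> ?A"
    have "prb (all_edges n) p (poor_expansion \<kappa> j S) \<le> exp (- (24 / \<kappa> * \<kappa> * real (card S) * d / 4))"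
      unfolding poor_expansion_def
      by (rule layer_lower_tail) (use S \<kappa> j in \<open>auto simp: mult_ac\<close>)
    also have "\<dots> \<le> (1 / real n ^ 3) ^ card S"
      using n2 \<kappa> by (intro exp_le_inverse_cube_power[OF _ lnd]) auto
    finally show "prb (all_edges n) p (poor_expansion \<kappa> j S) \<le> (1 / real n ^ 3) ^ card S" .
  qed
  also have "\<dots> \<le> 2 / real n ^ 2"
    using n2 by (intro sum_nonempty_subsets_le) auto
  finally show ?thesis .
qed

text \<open>Outside five bad events the graph satisfies the expansion hypotheses with
  \<open>K1 = 40\<close>, \<open>c = \<kappa> / 4\<close>, \<open>c0 = 1 / 960\<close> and the
  low-degree vertices as \<open>Z\<close>.\<close>

lemma cop_number_prob:
  fixes r :: nat and \<kappa> l \<gamma> :: real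
  assumes n4: "4 \<le> n" and lnd: "ln (real n) \<le> 2 * d"
    and r: "d ^ r \<le> sqrt (real n)" "sqrt (real n) < d * d ^ r" "2 \<le> r" "r + 2 \<le> n"
    and \<kappa>: "0 < \<kappa>" "\<kappa> \<le> 1" "1 \<le> \<kappa> * d" "192 / \<kappa> \<le> d" and l: "0 \<le> l"
    and d_large: "2 * exp 3 \<le> d\<^sup>2" and \<gamma>: "0 < \<gamma>" "\<gamma> * (\<kappa> / 4) * (1 / 960) = 96 * 40"
    and large: "d\<^sup>2 \<le> 1 / 960 * sqrt (real n)" "ln (4 * real n) \<le> sqrt (real n) / d"
      "\<gamma> \<le> sqrt (real n)" "1 \<le> \<gamma> * sqrt (real n)"
  shows "prb (all_edges n) p (\<lambda>E. \<not> real (cop_number {1..n} E) \<le> (1 + 8 * \<gamma>) * sqrt (real n))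
    \<le> 5 / real n ^ 2 + 2 * exp 3 / d\<^sup>2 + sqrt (real n) * exp (l * (16 * \<kappa> * d) - (1 - exp (- l)) * d)"
proof -
  define J where "J j = {S \<in> Pow {1..n} - {{}}. 960 * (real (card S) * d ^ j) \<le> real n}" for j
  define A where "A E \<longleftrightarrow> (\<exists>vi\<in>{1..n} \<times> {..<r + 2}.
      20 * d ^ Suc (snd vi) \<le> real (card (layer E {fst vi} (Suc (snd vi)))))" for E
  define Zb where "Zb E \<longleftrightarrow> sqrt (real n) \<le> real (card (low_degree n (16 * \<kappa> * d) E))" for E
  define L where "L j E \<longleftrightarrow> (\<exists>S\<in>J j. poor_expansion \<kappa> j S E)" for j E
  have det: "real (cop_number {1..n} E) \<le> (1 + 8 * \<gamma>) * sqrt (real n)"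
    if E: "E \<subseteq> all_edges n" and nA: "\<not> A E" and sp: "locally_sparse n d E" and nZ: "\<not> Zb E"
      and nL: "\<not> L (Suc r) E" "\<not> L (Suc (Suc r)) E" for E
  proof (rule cop_number_le_of_expansion[OF E])
    have lay: "real (card (layer E {v} (Suc i))) < 20 * d ^ Suc i" if "v \<in> {1..n}" "i < r + 2" for v i
      using nA that unfolding A_def by (force simp: not_le)
    have gr: "real (card (reach E k {v})) \<le> 40 * d ^ k" if "v \<in> {1..n}" "k \<le> r + 2" for v k
      using reach_card_le[OF E that(1) lay[OF that(1)] that(2)] .
    show "low_degree n (16 * \<kappa> * d) E \<subseteq> {1..n}" by (auto simp: low_degree_def)
    show "real (card (low_degree n (16 * \<kappa> * d) E)) \<le> sqrt (real n)" using nZ by (simp add: Zb_def)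
    show "real (card (reach E r {v})) \<le> 40 * d ^ r" if "v \<in> {1..n}" for v using gr that by simp
    show "real (card (reach E 1 {v})) \<le> 40 * d" if "v \<in> {1..n}" for v using gr[of v 1] that by simp
    fix S j
    assume S: "S \<subseteq> {1..n} - low_degree n (16 * \<kappa> * d) E" "S \<noteq> {}"
      and j: "j \<in> {Suc r, Suc (Suc r)}" and small: "real (card S) * d ^ j \<le> 1 / 960 * real n"
    have SV: "S \<subseteq> {1..n}" using S by blast
    have "S \<in> J j" using SV S small by (simp add: J_def)
    then have "\<not> poor_expansion \<kappa> j S E" using nL j unfolding L_def by blast
    moreover have "\<kappa> * d * real (card S) \<le> real (card (layer E S 1))"
    proof (rule first_layer_large[OF E SV S(2) _ sp \<kappa>(3)])
      \<comment> \<open>\<open>r \<ge> 2\<close> yields \<open>j \<ge> 3\<close>, so the size limit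
        for the first layer follows from that for layer \<open>j\<close>.\<close>
      have "d ^ 3 \<le> d ^ j" using j r(3) d4 by (intro power_increasing) auto
      then have "real (card S) * d ^ 3 \<le> real (card S) * d ^ j" by (intro mult_left_mono) auto
      moreover have "\<kappa> * (real (card S) * d ^ 3) \<le> 1 * (real (card S) * d ^ 3)"
        using \<kappa> d4 by (intro mult_right_mono) auto
      ultimately show "2 * \<kappa> * real (card S) * d ^ 3 \<le> real n" using small by simp
    qed (use S in blast)
    moreover have "real (card (reach E k S)) \<le> real (card S) * 40 * d ^ k" if "k < j" for k
    proof -
      have "real (card (reach E k S)) \<le> real (card S) * (40 * d ^ k)"
        using that j SV by (intro reach_card_le_set[OF E SV] gr) auto
      then show ?thesis by simp
    qed
    ultimately have "\<kappa> / 4 * real (card S) * d ^ j < real (card (layer E S j))"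
      unfolding poor_expansion_def by (meson not_le)
    also have "\<dots> \<le> real (card (reach E j S))"
      using finite_reach[OF E SV] by (intro of_nat_mono card_mono) (auto simp: layer_def)
    finally show "\<kappa> / 4 * real (card S) * d ^ j \<le> real (card (reach E j S))" by simp
  qed (use n4 d4 lnd r \<kappa> \<gamma> large in auto)
  have "prb (all_edges n) p (\<lambda>E. \<not> real (cop_number {1..n} E) \<le> (1 + 8 * \<gamma>) * sqrt (real n))
    \<le> prb (all_edges n) p (\<lambda>E. A E \<or> \<not> locally_sparse n d E \<or> Zb E \<or> L (Suc r) E \<or> L (Suc (Suc r)) E)"
    by (rule prb_mono[OF p0 p1]) (use det in blast)
  also have "\<dots> \<le> prb (all_edges n) p A + (prb (all_edges n) p (\<lambda>E. \<not> locally_sparse n d E)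
      + (prb (all_edges n) p Zb + (prb (all_edges n) p (L (Suc r)) + prb (all_edges n) p (L (Suc (Suc r))))))"
    by (intro order_trans[OF prb_disj_le[OF p0 p1]] add_left_mono order_refl)
  also have "\<dots> \<le> 1 / real n ^ 2 + (2 * exp 3 / d\<^sup>2
      + (sqrt (real n) * exp (l * (16 * \<kappa> * d) - (1 - exp (- l)) * d) + (2 / real n ^ 2 + 2 / real n ^ 2)))"
    unfolding A_def Zb_def L_def J_def
    by (intro add_mono large_layer_prob lnd r not_locally_sparse_prob d_large many_low_degree_prob l
        poor_expansion_prob \<kappa>) auto
  finally show ?thesis by simp
qed

end

section \<open>Choice of the radius and passage to the limit\<close>

lemma exists_power_bracket:
  fixes d x :: real
  assumes "1 < d" "d\<^sup>2 \<le> x"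
  shows "\<exists>r\<ge>2. d ^ r \<le> x \<and> x < d * d ^ r"
proof -
  have "\<exists>k. x < d ^ k" using real_arch_pow[OF assms(1)] .
  define k where "k = (LEAST k. x < d ^ k)"
  have k: "x < d ^ k" unfolding k_def by (rule LeastI_ex) fact
  have least: "d ^ j \<le> x" if "j < k" for j
    using not_less_Least[of j "\<lambda>k. x < d ^ k"] that by (simp add: k_def not_less)
  have "2 < k"
  proof (rule ccontr)
    assume "\<not> 2 < k"
    then have "d ^ k \<le> d ^ 2" using assms(1) by (intro power_increasing) auto
    then show False using k assms(2) by simp
  qed
  then obtain r where r: "k = Suc r" "2 \<le> r" by (cases k) auto
  show ?thesis using r k least[of r] by (intro exI[of _ r]) auto
qed

theorem theorem4p4:
  fixes \<epsilon> :: real and d :: "nat \<Rightarrow> real"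
  assumes "0 < \<epsilon>" and "\<epsilon> < 1"
    and "\<forall>\<^sub>F n in sequentially. (1/2 + \<epsilon>) * ln (real n) \<le> d n \<and> d n \<le> (ln (real n)) ^ 3"
  shows "\<exists>K::real. (\<lambda>n. Gnp_prob n (d n / (real n - 1))
            (\<lambda>E. real (cop_number {1..n} E) \<le> K * sqrt (real n))) \<longlonglongrightarrow> 1"
proof -
  \<comment> \<open>With these values \<open>exp (- l) = \<epsilon> / 4\<close> and
    \<open>l * 16 * \<kappa> = \<epsilon> / 4\<close>, so the bound for one low degree becomes
    \<open>exp (- (1 - \<epsilon> / 2) * d)\<close>.\<close>
  define l where "l = ln (4 / \<epsilon>)"
  define \<kappa> where "\<kappa> = \<epsilon> / (64 * l)"
  \<comment> \<open>Solves \<open>\<gamma> * c * c0 = 96 * K1\<close> for the constants of the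
    random graph.\<close>
  define \<gamma> where "\<gamma> = 96 * 40 * 960 * 4 / \<kappa>"
  define D where "D = Max {4, 1 / \<kappa>, 192 / \<kappa>, exp 3}"
  define g where "g n = 5 / real n ^ 2 + 8 * exp 3 / ln (real n) ^ 2 + real n powr (- \<epsilon> / 4)" for n
  have l1: "1 \<le> l"
  proof -
    have "exp 1 \<le> 4 / \<epsilon>"
      using exp_le assms(1,2) by (intro order_trans[OF exp_le]) (auto simp: field_simps)
    then show ?thesis using assms(1) unfolding l_def by (simp add: ln_ge_iff)
  qed
  have el: "exp (- l) = \<epsilon> / 4" using assms(1) by (simp add: l_def exp_minus)
  have \<kappa>: "0 < \<kappa>" "\<kappa> \<le> 1"
    using l1 assms(1,2) by (auto simp: \<kappa>_def field_simps)
  have \<kappa>l: "l * (16 * \<kappa>) = \<epsilon> / 4" using l1 by (simp add: \<kappa>_def)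
  have \<gamma>: "0 < \<gamma>" "\<gamma> * (\<kappa> / 4) * (1 / 960) = 96 * 40" using \<kappa> by (auto simp: \<gamma>_def)
  have ev1: "\<forall>\<^sub>F n in sequentially. D \<le> ln (real n) / 2" by real_asymp
  have ev2: "\<forall>\<^sub>F n in sequentially. ln (real n) ^ 3 \<le> real n - 1" by real_asymp
  have ev3: "\<forall>\<^sub>F n in sequentially. (ln (real n) ^ 3)\<^sup>2 \<le> 1 / 960 * sqrt (real n)" by real_asymp
  have ev4: "\<forall>\<^sub>F n in sequentially. ln (4 * real n) \<le> sqrt (real n) / ln (real n) ^ 3" by real_asymp
  have ev5: "\<forall>\<^sub>F n in sequentially. \<gamma> \<le> sqrt (real n)" by real_asymp
  have ev6: "\<forall>\<^sub>F n in sequentially. 1 \<le> \<gamma> * sqrt (real n)" using \<gamma>(1) by real_asymp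
  have main: "\<forall>\<^sub>F n in sequentially.
      1 - g n \<le> Gnp_prob n (d n / (real n - 1))
        (\<lambda>E. real (cop_number {1..n} E) \<le> (1 + 8 * \<gamma>) * sqrt (real n)) \<and>
      Gnp_prob n (d n / (real n - 1))
        (\<lambda>E. real (cop_number {1..n} E) \<le> (1 + 8 * \<gamma>) * sqrt (real n)) \<le> 1"
    using assms(3) ev1 ev2 ev3 ev4 ev5 ev6 eventually_ge_at_top[of 4]
  proof eventually_elim
    case (elim n)
    note hd = elim(1)
    have n4: "4 \<le> n" by (rule elim(8))
    have ln0: "0 < ln (real n)" using n4 by simp
    have D: "4 \<le> D" "1 / \<kappa> \<le> D" "192 / \<kappa> \<le> D" "exp 3 \<le> D" unfolding D_def by simp_all
    have half: "ln (real n) / 2 \<le> d n"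
    proof -
      have "(1 / 2) * ln (real n) \<le> (1 / 2 + \<epsilon>) * ln (real n)"
        using ln0 assms(1) by (intro mult_right_mono) auto
      then show ?thesis using hd by simp
    qed
    then have Dd: "D \<le> d n" using elim(2) by linarith
    have d4: "4 \<le> d n" using D Dd by linarith
    have d0: "0 < d n" using d4 by simp
    have p1: "d n / (real n - 1) \<le> 1"
      using hd elim(3) n4 by simp
    interpret sparse_gnp n "d n" "d n / (real n - 1)"
      by unfold_locales (use n4 d4 p1 in auto)
    have d2: "(d n)\<^sup>2 \<le> 1 / 960 * sqrt (real n)"
    proof -
      have "(d n)\<^sup>2 \<le> (ln (real n) ^ 3)\<^sup>2" using hd d0 by (intro power_mono) auto
      then show ?thesis using elim(4) by linarith
    qed
    have "(d n)\<^sup>2 \<le> sqrt (real n)" using d2 real_sqrt_ge_zero[of "real n"] by linarith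
    then obtain r where r: "2 \<le> r" "d n ^ r \<le> sqrt (real n)" "sqrt (real n) < d n * d n ^ r"
      using exists_power_bracket[of "d n"] d4 by auto
    have rn: "r + 2 \<le> n"
    proof -
      have "real r + 1 \<le> 2 ^ r"
      proof -
        have "r < 2 ^ r" by (rule less_exp)
        then have "r + 1 \<le> 2 ^ r" by (simp only: Suc_eq_plus1[symmetric] Suc_le_eq)
        then have "real (r + 1) \<le> real (2 ^ r)" by (rule of_nat_mono)
        then show ?thesis by simp
      qed
      also have "\<dots> \<le> d n ^ r" using d4 by (intro power_mono) auto
      also have "\<dots> \<le> sqrt (real n)" by (rule r(2))
      also have "\<dots> \<le> real n / 2"
      proof -
        have "sqrt (real n) * 2 \<le> sqrt (real n) * sqrt (real n)"
          using n4 real_sqrt_le_mono[of 4 "real n"] by (intro mult_left_mono) auto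
        then show ?thesis by simp
      qed
      finally show ?thesis using n4 by linarith
    qed
    have lnd: "ln (real n) \<le> 2 * d n" using half by simp
    have kd: "1 \<le> \<kappa> * d n"
    proof -
      have "1 / \<kappa> \<le> d n" using D Dd by linarith
      then show ?thesis using \<kappa> by (simp add: field_simps)
    qed
    have de3: "2 * exp 3 \<le> (d n)\<^sup>2"
      unfolding power2_eq_square using D Dd d4 by (intro mult_mono) auto
    have ln4: "ln (4 * real n) \<le> sqrt (real n) / d n"
    proof -
      have "sqrt (real n) / ln (real n) ^ 3 \<le> sqrt (real n) / d n"
        using hd d0 ln0 by (intro divide_left_mono mult_pos_pos) auto
      then show ?thesis using elim(5) by linarith
    qed
    define x where "x = prb (all_edges n) (d n / (real n - 1))
      (\<lambda>E. \<not> real (cop_number {1..n} E) \<le> (1 + 8 * \<gamma>) * sqrt (real n))"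
    have x0: "0 \<le> x" unfolding x_def by (rule prb_nonneg[OF p0 p1])
    have "x \<le> 5 / real n ^ 2 + 2 * exp 3 / (d n)\<^sup>2
        + sqrt (real n) * exp (l * (16 * \<kappa> * d n) - (1 - exp (- l)) * d n)"
      unfolding x_def
      by (rule cop_number_prob[OF n4 lnd r(2,3,1) rn \<kappa> kd _ _ de3 \<gamma> d2 ln4 elim(6,7)])
        (use D Dd l1 in linarith)+
    also have "\<dots> \<le> g n"
    proof -
      have "2 * exp 3 / (d n)\<^sup>2 \<le> 2 * exp 3 / (ln (real n) / 2)\<^sup>2"
        using half ln0 d0 by (intro divide_left_mono power_mono) auto
      also have "\<dots> = 8 * exp 3 / ln (real n) ^ 2" by (simp add: power_divide)
      finally have t2: "2 * exp 3 / (d n)\<^sup>2 \<le> 8 * exp 3 / ln (real n) ^ 2" .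
      have "l * (16 * \<kappa> * d n) - (1 - exp (- l)) * d n = - ((1 - \<epsilon> / 2) * d n)"
      proof -
        have eq: "l * (16 * \<kappa> * d n) = (l * (16 * \<kappa>)) * d n" by (simp only: mult.assoc)
        show ?thesis unfolding eq el \<kappa>l by (simp add: algebra_simps)
      qed
      \<comment> \<open>The lower bound on \<open>d\<close> is spent here:
        \<open>(1 - \<epsilon> / 2) * (1 / 2 + \<epsilon>)\<close> still exceeds 1/2 by at least
        \<open>\<epsilon> / 4\<close>, so after multiplication by \<open>sqrt n\<close> a negative
        power of \<open>n\<close> remains.\<close>
      also have "\<dots> \<le> - ((1 - \<epsilon> / 2) * ((1 / 2 + \<epsilon>) * ln (real n)))"
        using hd assms(2) by simp
      also have "\<dots> \<le> - ((1 / 2 + \<epsilon> / 4) * ln (real n))"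
      proof -
        have "\<epsilon> * \<epsilon> \<le> 1 * \<epsilon>" using assms by (intro mult_right_mono) auto
        then have "1 / 2 + \<epsilon> / 4 \<le> (1 - \<epsilon> / 2) * (1 / 2 + \<epsilon>)" by (simp add: algebra_simps)
        from mult_right_mono[OF this, of "ln (real n)"] show ?thesis using ln0 by (simp add: mult.assoc)
      qed
      finally have "exp (l * (16 * \<kappa> * d n) - (1 - exp (- l)) * d n)
          \<le> exp (- ((1 / 2 + \<epsilon> / 4) * ln (real n)))" by simp
      then have "sqrt (real n) * exp (l * (16 * \<kappa> * d n) - (1 - exp (- l)) * d n)
          \<le> sqrt (real n) * exp (- ((1 / 2 + \<epsilon> / 4) * ln (real n)))"
        by (intro mult_left_mono) auto
      also have "\<dots> = real n powr (- \<epsilon> / 4)"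
      proof -
        have "sqrt (real n) = exp (1 / 2 * ln (real n))"
          using n4 by (simp add: powr_half_sqrt[symmetric] powr_def)
        then have "sqrt (real n) * exp (- ((1 / 2 + \<epsilon> / 4) * ln (real n)))
            = exp (1 / 2 * ln (real n) + - ((1 / 2 + \<epsilon> / 4) * ln (real n)))"
          by (simp only: exp_add)
        also have "1 / 2 * ln (real n) + - ((1 / 2 + \<epsilon> / 4) * ln (real n)) = - \<epsilon> / 4 * ln (real n)"
          by (simp add: algebra_simps)
        finally show ?thesis using n4 by (simp add: powr_def)
      qed
      finally show ?thesis using t2 by (simp add: g_def)
    qed
    finally have "x \<le> g n" .
    moreover have "Gnp_prob n (d n / (real n - 1))
        (\<lambda>E. real (cop_number {1..n} E) \<le> (1 + 8 * \<gamma>) * sqrt (real n)) = 1 - x"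
      unfolding Gnp_prob_eq_prb x_def by (simp add: prb_Not)
    ultimately show ?case using x0 by simp
  qed
  have g0: "g \<longlonglongrightarrow> 0" unfolding g_def using assms(1) by real_asymp
  have "(\<lambda>n. Gnp_prob n (d n / (real n - 1))
      (\<lambda>E. real (cop_number {1..n} E) \<le> (1 + 8 * \<gamma>) * sqrt (real n))) \<longlonglongrightarrow> 1"
  proof (rule tendsto_sandwich)
    show "\<forall>\<^sub>F n in sequentially. 1 - g n \<le> Gnp_prob n (d n / (real n - 1))
        (\<lambda>E. real (cop_number {1..n} E) \<le> (1 + 8 * \<gamma>) * sqrt (real n))"
      using main by eventually_elim simp
    show "\<forall>\<^sub>F n in sequentially. Gnp_prob n (d n / (real n - 1))
        (\<lambda>E. real (cop_number {1..n} E) \<le> (1 + 8 * \<gamma>) * sqrt (real n)) \<le> 1"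
      using main by eventually_elim simp
    show "(\<lambda>n. 1 - g n) \<longlonglongrightarrow> 1" using tendsto_diff[OF tendsto_const g0, of 1] by simp
  qed simp
  then show ?thesis by blast
qed

end
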